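(* Let $H$ be a co-Frobenius Hopf algebra over a field $k$, with antipode $S$ and counit $\varepsilon$. The following are equivalent: (i) $H$ is cosemisimple and involutory. (ii) There is a non-zero left or right integral $\lambda$ for $H$ in $H^*$ such that $\lambda(S(h_2)h_1)=\varepsilon(h)$ for all $h\in H$. (iii) There is a non-zero left or right integral $\lambda$ for $H$ in $H^*$ such that $\lambda(h_2S(h_1))=\varepsilon(h)$ for all $h\in H$. (iv) $H$ is cosemisimple and there is a non-zero cocommutative integral for $H$ in $H^*$.
   Context: $H$ is not assumed finite dimensional. Sweedler notation $\Delta(h)=h_1\otimes h_2$ (summation understood) is used. $\lambda\in H^*$ is a left integral for $H$ in $H^*$ if $h_1\lambda(h_2)=\lambda(h)1$ for all $h\in H$, and a right integral if $\lambda(h_1)h_2=\lambda(h)1$ for all $h\in H$. $H$ is co-Frobenius if there is a non-zero left integral for $H$ in $H^*$ (equivalently, a non-zero right integral); then the spaces of left and of right integrals are one dimensional and the antipode is bijective. An integral (left or right) $\Gamma\in H^*$ for $H$ is cocommutative if $\Gamma(hh')=\Gamma(h'h)$ for all $h,h'\in H$. $H$ is involutory if $S^2=\mathrm{id}_H$. *)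

theory Defs
  imports HOL.Vector_Spaces "HOL-Library.Poly_Mapping"
begin

text \<open>
  The free vector space over a field on a set of symbols consists of the finitely supported
  functions. A list of symbols stands for the formal sum of its entries.
\<close>

definition free_scale :: "'k::field \<Rightarrow> ('x \<Rightarrow>\<^sub>0 'k) \<Rightarrow> ('x \<Rightarrow>\<^sub>0 'k)" where
  "free_scale c u = Poly_Mapping.map ((*) c) u"

abbreviation gen :: "'x \<Rightarrow> 'x \<Rightarrow>\<^sub>0 'k::field" where
  "gen x \<equiv> Poly_Mapping.single x 1"

definition formal_sum :: "'x list \<Rightarrow> ('x \<Rightarrow>\<^sub>0 'k::field)" where
  "formal_sum xs = (\<Sum>x\<leftarrow>xs. gen x)"

lemma lookup_free_scale [simp]:
  "Poly_Mapping.lookup (free_scale c u) x = c * Poly_Mapping.lookup u x"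
  by (simp add: free_scale_def map.rep_eq when_def)

lemma vector_space_free: "vector_space free_scale"
  by standard (auto intro!: poly_mapping_eqI simp: lookup_add algebra_simps)

text \<open>
  For a vector space \<open>V\<close>, the quotient of the free vector space on \<open>V \<times> V\<close> by the span of
  the relations \<open>bilin_rels\<close> is \<open>V \<otimes> V\<close>; likewise \<open>V \<otimes> V \<otimes> V\<close> with \<open>trilin_rels\<close>. A list
  \<open>[(a\<^sub>1, b\<^sub>1), \<dots>, (a\<^sub>n, b\<^sub>n)]\<close> denotes the element \<open>a\<^sub>1 \<otimes> b\<^sub>1 + \<dots> + a\<^sub>n \<otimes> b\<^sub>n\<close> of the
  quotient. Since \<open>c(a \<otimes> b) = (ca) \<otimes> b\<close>, every element is denoted by some list, and
  \<open>tensor2_eq\<close>, \<open>tensor3_eq\<close> are equality in the quotient.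
\<close>

context
  fixes scale :: "'k::field \<Rightarrow> 'v::ab_group_add \<Rightarrow> 'v"
begin

definition bilin_rels :: "('v \<times> 'v \<Rightarrow>\<^sub>0 'k) set" where
  "bilin_rels =
     {gen (a + a', b) - gen (a, b) - gen (a', b) |a a' b. True} \<union>
     {gen (a, b + b') - gen (a, b) - gen (a, b') |a b b'. True} \<union>
     {gen (scale c a, b) - free_scale c (gen (a, b)) |c a b. True} \<union>
     {gen (a, scale c b) - free_scale c (gen (a, b)) |c a b. True}"

definition trilin_rels :: "('v \<times> 'v \<times> 'v \<Rightarrow>\<^sub>0 'k) set" where
  "trilin_rels =
     {gen (x + x', y, z) - gen (x, y, z) - gen (x', y, z) |x x' y z. True} \<union>
     {gen (x, y + y', z) - gen (x, y, z) - gen (x, y', z) |x y y' z. True} \<union>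
     {gen (x, y, z + z') - gen (x, y, z) - gen (x, y, z') |x y z z'. True} \<union>
     {gen (scale c x, y, z) - free_scale c (gen (x, y, z)) |c x y z. True} \<union>
     {gen (x, scale c y, z) - free_scale c (gen (x, y, z)) |c x y z. True} \<union>
     {gen (x, y, scale c z) - free_scale c (gen (x, y, z)) |c x y z. True}"

definition tensor2_eq :: "('v \<times> 'v) list \<Rightarrow> ('v \<times> 'v) list \<Rightarrow> bool" where
  "tensor2_eq s t \<longleftrightarrow> formal_sum s - formal_sum t \<in> module.span free_scale bilin_rels"

definition tensor3_eq :: "('v \<times> 'v \<times> 'v) list \<Rightarrow> ('v \<times> 'v \<times> 'v) list \<Rightarrow> bool" where
  "tensor3_eq s t \<longleftrightarrow> formal_sum s - formal_sum t \<in> module.span free_scale trilin_rels"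

end

text \<open>
  The comultiplication is given by a choice, for each \<open>h\<close>, of a finite sum of pure tensors
  representing \<open>\<Delta>(h)\<close>. Hence \<open>h\<^sub>1 \<otimes> h\<^sub>2\<close> of Sweedler notation is an entry \<open>(h1, h2)\<close>
  of \<open>comult h\<close>, with summation over the list, and all identities between tensors are stated
  up to \<open>tensor2_eq\<close> and \<open>tensor3_eq\<close>. Expressions that are multilinear in the Sweedler
  components do not depend on the choice; see \<open>tensor2_eq_sum_list\<close> and \<open>tensor3_eq_sum_list\<close>.
\<close>

locale coalgebra = vector_space scale
  for scale :: "'k::field \<Rightarrow> 'h::ab_group_add \<Rightarrow> 'h" (infixr \<open>*s\<close> 75) +
  fixes comult :: "'h \<Rightarrow> ('h \<times> 'h) list"
    and counit :: "'h \<Rightarrow> 'k"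
  assumes comult_add: "tensor2_eq scale (comult (g + h)) (comult g @ comult h)"
    and comult_scale: "tensor2_eq scale (comult (c *s h)) [(c *s h1, h2). (h1, h2) \<leftarrow> comult h]"
    and counit_linear: "Vector_Spaces.linear scale (*) counit"
    and coassoc:
      "tensor3_eq scale
         [(h11, h12, h2). (h1, h2) \<leftarrow> comult h, (h11, h12) \<leftarrow> comult h1]
         [(h1, h21, h22). (h1, h2) \<leftarrow> comult h, (h21, h22) \<leftarrow> comult h2]"
    and counit_left: "(\<Sum>(h1, h2)\<leftarrow>comult h. counit h1 *s h2) = h"
    and counit_right: "(\<Sum>(h1, h2)\<leftarrow>comult h. counit h2 *s h1) = h"
begin

definition subcoalgebra :: "'h set \<Rightarrow> bool" where
  "subcoalgebra D \<longleftrightarrow>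
     subspace D \<and> (\<forall>d\<in>D. \<exists>t. set t \<subseteq> D \<times> D \<and> tensor2_eq scale (comult d) t)"

definition simple_subcoalgebra :: "'h set \<Rightarrow> bool" where
  "simple_subcoalgebra D \<longleftrightarrow>
     subcoalgebra D \<and> D \<noteq> {0} \<and>
     (\<forall>E. subcoalgebra E \<and> E \<subseteq> D \<longrightarrow> E = {0} \<or> E = D)"

text \<open>A coalgebra is cosemisimple if it is the sum of its simple subcoalgebras.\<close>

definition cosemisimple :: bool where
  "cosemisimple \<longleftrightarrow> span (\<Union>{D. simple_subcoalgebra D}) = UNIV"

end

text \<open>
  The class \<open>ring_1\<close> requires \<open>0 \<noteq> 1\<close>, which is no restriction because \<open>\<epsilon>(1) = 1\<close>.
\<close>

locale hopf_algebra = coalgebra scale comult counit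
  for scale :: "'k::field \<Rightarrow> 'h::ring_1 \<Rightarrow> 'h" (infixr \<open>*s\<close> 75)
    and comult :: "'h \<Rightarrow> ('h \<times> 'h) list"
    and counit :: "'h \<Rightarrow> 'k" +
  fixes antipode :: "'h \<Rightarrow> 'h"
  assumes mult_scale_left: "(c *s g) * h = c *s (g * h)"
    and mult_scale_right: "g * (c *s h) = c *s (g * h)"
    and comult_mult:
      "tensor2_eq scale (comult (g * h))
         [(g1 * h1, g2 * h2). (g1, g2) \<leftarrow> comult g, (h1, h2) \<leftarrow> comult h]"
    and comult_one: "tensor2_eq scale (comult 1) [(1, 1)]"
    and counit_mult: "counit (g * h) = counit g * counit h"
    and counit_one: "counit 1 = 1"
    and antipode_linear: "Vector_Spaces.linear scale scale antipode"
    and antipode_left: "(\<Sum>(h1, h2)\<leftarrow>comult h. antipode h1 * h2) = counit h *s 1"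
    and antipode_right: "(\<Sum>(h1, h2)\<leftarrow>comult h. h1 * antipode h2) = counit h *s 1"
begin

text \<open>Integrals are elements of the dual space, and are allowed to be zero.\<close>

definition left_integral :: "('h \<Rightarrow> 'k) \<Rightarrow> bool" where
  "left_integral l \<longleftrightarrow>
     Vector_Spaces.linear scale (*) l \<and>
     (\<forall>h. (\<Sum>(h1, h2)\<leftarrow>comult h. l h2 *s h1) = l h *s 1)"

definition right_integral :: "('h \<Rightarrow> 'k) \<Rightarrow> bool" where
  "right_integral l \<longleftrightarrow>
     Vector_Spaces.linear scale (*) l \<and>
     (\<forall>h. (\<Sum>(h1, h2)\<leftarrow>comult h. l h1 *s h2) = l h *s 1)"

definition co_frobenius :: bool where
  "co_frobenius \<longleftrightarrow> (\<exists>l. left_integral l \<and> l \<noteq> (\<lambda>_. 0))"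

definition cocommutative :: "('h \<Rightarrow> 'k) \<Rightarrow> bool" where
  "cocommutative l \<longleftrightarrow> (\<forall>g h. l (g * h) = l (h * g))"

definition involutory :: bool where
  "involutory \<longleftrightarrow> antipode \<circ> antipode = id"

end

lemma free_extension:
  fixes scale :: "'k::field \<Rightarrow> 'v::ab_group_add \<Rightarrow> 'v" and f :: "'x \<Rightarrow> 'v"
  assumes "vector_space scale"
  obtains F where "Vector_Spaces.linear free_scale scale F" and "\<And>x. F (gen x) = f x"
proof -
  interpret vector_space scale by fact
  define F where
    "F u = (\<Sum>x\<in>Poly_Mapping.keys u. scale (Poly_Mapping.lookup u x) (f x))" for u
  have F: "F u = (\<Sum>x\<in>A. scale (Poly_Mapping.lookup u x) (f x))"
    if "finite A" "Poly_Mapping.keys u \<subseteq> A" for u A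
    unfolding F_def using that
    by (intro sum.mono_neutral_left) (auto simp: in_keys_iff)
  have add: "F (u + v) = F u + F v" for u v
  proof -
    let ?A = "Poly_Mapping.keys u \<union> Poly_Mapping.keys v"
    show ?thesis
      using Poly_Mapping.keys_add[of u v]
      by (simp add: F[of ?A] lookup_add scale_left_distrib sum.distrib)
  qed
  have scale: "F (free_scale c u) = scale c (F u)" for c u
  proof -
    have "Poly_Mapping.keys (free_scale c u) \<subseteq> Poly_Mapping.keys u"
      by (auto simp: in_keys_iff)
    then show ?thesis
      by (simp add: F[of "Poly_Mapping.keys u"] scale_sum_right)
  qed
  have "Vector_Spaces.linear free_scale scale F"
    unfolding Vector_Spaces.linear_iff by (simp add: vector_space_free assms add scale)
  moreover have "F (gen x) = f x" for x
    by (simp add: F_def)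
  ultimately show thesis
    by (rule that)
qed

lemma formal_sum_diff_in_span:
  fixes scale :: "'k::field \<Rightarrow> 'v::ab_group_add \<Rightarrow> 'v"
  assumes "Vector_Spaces.linear free_scale scale F"
    and "\<And>u. u \<in> R \<Longrightarrow> F u = 0"
    and "formal_sum s - formal_sum t \<in> module.span free_scale R"
  shows "(\<Sum>x\<leftarrow>s. F (gen x)) = (\<Sum>x\<leftarrow>t. F (gen x))"
proof -
  interpret F: Vector_Spaces.linear free_scale scale F by fact
  have sum: "F (formal_sum r) = (\<Sum>x\<leftarrow>r. F (gen x))" for r
    unfolding formal_sum_def by (induction r) (simp_all add: F.add F.zero)
  have "F (formal_sum s - formal_sum t) = 0"
    by (rule F.eq_0_on_span[OF assms(2,3)])
  then show ?thesis
    by (simp add: F.diff sum)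
qed

lemma tensor2_eq_sum_list:
  fixes scale2 :: "'k::field \<Rightarrow> 'w::ab_group_add \<Rightarrow> 'w"
  assumes "\<And>b. Vector_Spaces.linear scale scale2 (\<lambda>a. f a b)"
    and "\<And>a. Vector_Spaces.linear scale scale2 (f a)"
    and "tensor2_eq scale s t"
  shows "(\<Sum>(a, b)\<leftarrow>s. f a b) = (\<Sum>(a, b)\<leftarrow>t. f a b)"
proof -
  interpret L: Vector_Spaces.linear scale scale2 "\<lambda>a. f a b" for b by fact
  interpret R: Vector_Spaces.linear scale scale2 "f a" for a by fact
  obtain F where F: "Vector_Spaces.linear free_scale scale2 F"
    and gen: "\<And>x. F (gen x) = (\<lambda>(a, b). f a b) x"
    using free_extension[OF L.vs2.vector_space_axioms] by blast
  interpret F: Vector_Spaces.linear free_scale scale2 F by fact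
  have "F u = 0" if "u \<in> bilin_rels scale" for u
    using that unfolding bilin_rels_def
    by (auto simp: F.diff F.scale gen L.add R.add L.scale R.scale)
  from formal_sum_diff_in_span[OF F this] assms(3) show ?thesis
    by (simp add: tensor2_eq_def gen)
qed

lemma tensor3_eq_sum_list:
  fixes scale2 :: "'k::field \<Rightarrow> 'w::ab_group_add \<Rightarrow> 'w"
  assumes "\<And>y z. Vector_Spaces.linear scale scale2 (\<lambda>x. f x y z)"
    and "\<And>x z. Vector_Spaces.linear scale scale2 (\<lambda>y. f x y z)"
    and "\<And>x y. Vector_Spaces.linear scale scale2 (f x y)"
    and "tensor3_eq scale s t"
  shows "(\<Sum>(x, y, z)\<leftarrow>s. f x y z) = (\<Sum>(x, y, z)\<leftarrow>t. f x y z)"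
proof -
  interpret A: Vector_Spaces.linear scale scale2 "\<lambda>x. f x y z" for y z by fact
  interpret B: Vector_Spaces.linear scale scale2 "\<lambda>y. f x y z" for x z by fact
  interpret C: Vector_Spaces.linear scale scale2 "f x y" for x y by fact
  obtain F where F: "Vector_Spaces.linear free_scale scale2 F"
    and gen: "\<And>p. F (gen p) = (\<lambda>(x, y, z). f x y z) p"
    using free_extension[OF A.vs2.vector_space_axioms] by blast
  interpret F: Vector_Spaces.linear free_scale scale2 F by fact
  have "F u = 0" if "u \<in> trilin_rels scale" for u
    using that unfolding trilin_rels_def
    by (auto simp: F.diff F.scale gen A.add B.add C.add A.scale B.scale C.scale)
  from formal_sum_diff_in_span[OF F this] assms(4) show ?thesis
    by (simp add: tensor3_eq_def gen)
qed

end

theory Submission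
  imports Defs
begin

text \<open>
  A left integral \<open>\<lambda>\<close> with \<open>\<lambda>(1) = 1\<close> gives a coseparability form \<open>\<lambda>(hS(g))\<close>, so every subcoalgebra has
  a complement and \<open>H\<close> is cosemisimple by Zorn's lemma. Conversely, in a cosemisimple \<open>H\<close> the line
  \<open>k1\<close> has a complementary subcoalgebra, and the corresponding projection is a two-sided integral \<open>\<mu>\<close>
  with \<open>\<mu>(1) = 1\<close>, of which all integrals are multiples. Evaluating (ii) and (iii) at \<open>1\<close> gives
  \<open>\<lambda>(1) = 1\<close>, hence \<open>\<lambda> = \<mu>\<close>. The relation of these conditions and of cocommutativity to \<open>S\<^sup>2 = id\<close>
  follows from the shift identities \<open>g\<^sub>1\<mu>(hg\<^sub>2) = S(h\<^sub>1)\<mu>(h\<^sub>2g)\<close> for left and \<open>\<mu>(h\<^sub>1g)h\<^sub>2 = \<mu>(hg\<^sub>1)S(g\<^sub>2)\<close>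
  for right integrals.
\<close>

section \<open>Coalgebras\<close>

text \<open>\<open>comult h\<close> is a list, not a tensor: for \<open>d\<close> in a subcoalgebra
  \<open>D\<close> its entries may lie outside \<open>D\<close>, and many lists represent the same
  tensor. So Sweedler components can be rearranged only under a multilinear map. Conversely,
  bilinear forms detect equality of tensors, and contractions of \<open>comult d\<close> with
  functionals detect whether both legs can be taken in \<open>D\<close>.

  Integrals and complements meet because \<open>h \<mapsto> \<mu>(h)1\<close> is a bicolinear
  projection onto \<open>k1\<close>; the coseparability form produces such projections onto every
  subcoalgebra.

  A second obstacle is the side of the integral: (ii) combines with the left shift and (iii) with
  the right one, while the given \<open>\<lambda>\<close> may be of either kind. The normalization
  \<open>\<lambda>(1) = 1\<close> is what allows passing to the other side.\<close>

context coalgebra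
begin

text \<open>
  Since \<open>comult h\<close> is only a representative of \<open>\<Delta>(h)\<close>, the sum \<open>sweedler h F\<close> is meaningful for bilinear \<open>F\<close>
  only.
\<close>

definition sweedler :: "'h \<Rightarrow> ('h \<Rightarrow> 'h \<Rightarrow> 'w::ab_group_add) \<Rightarrow> 'w" where
  "sweedler h F = (\<Sum>(a, b)\<leftarrow>comult h. F a b)"

section \<open>Linear maps and Sweedler sums\<close>

abbreviation lin :: "('k \<Rightarrow> 'w::ab_group_add \<Rightarrow> 'w) \<Rightarrow> ('h \<Rightarrow> 'w) \<Rightarrow> bool" where
  "lin s f \<equiv> Vector_Spaces.linear scale s f"

abbreviation bilin :: "('k \<Rightarrow> 'w::ab_group_add \<Rightarrow> 'w) \<Rightarrow> ('h \<Rightarrow> 'h \<Rightarrow> 'w) \<Rightarrow> bool" where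
  "bilin s F \<equiv> (\<forall>b. lin s (\<lambda>a. F a b)) \<and> (\<forall>a. lin s (F a))"

lemma vector_space_scalars: "vector_space ((*) :: 'k \<Rightarrow> 'k \<Rightarrow> 'k)"
  by standard (auto simp: algebra_simps)

lemma linI:
  assumes "vector_space s" "\<And>x y. f (x + y) = f x + f y" "\<And>c x. f (c *s x) = s c (f x)"
  shows "lin s f"
  using assms vector_space_axioms by (simp add: Vector_Spaces.linear_iff)

lemma linD:
  assumes "lin s f"
  shows "vector_space s" "f (x + y) = f x + f y" "f (c *s x) = s c (f x)" "f 0 = 0"
    "f (x - y) = f x - f y" "f (sum_list xs) = (\<Sum>x\<leftarrow>xs. f x)"
proof -
  interpret Vector_Spaces.linear scale s f by fact
  show "vector_space s" "f (x + y) = f x + f y" "f (c *s x) = s c (f x)" "f 0 = 0"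
    "f (x - y) = f x - f y"
    by (simp_all add: vs2.vector_space_axioms add scale zero diff)
  show "f (sum_list xs) = (\<Sum>x\<leftarrow>xs. f x)"
    by (induction xs) (simp_all add: add zero)
qed

lemma lin_id: "lin scale (\<lambda>x. x)"
  by (intro linI vector_space_axioms) simp_all

lemma lin_compose:
  assumes "lin s g" "lin scale f"
  shows "lin s (\<lambda>x. g (f x))"
  using assms by (intro linI) (simp_all add: linD)

lemma lin_scale_left:
  assumes "vector_space s" "lin (*) f"
  shows "lin s (\<lambda>x. s (f x) v)"
proof -
  interpret s: vector_space s by fact
  show ?thesis using assms by (intro linI) (simp_all add: linD s.scale_left_distrib)
qed

lemma lin_scale_right:
  assumes "lin s f"
  shows "lin s (\<lambda>x. s c (f x))"
proof -
  interpret s: vector_space s by (rule linD) fact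
  show ?thesis using assms
    by (intro linI) (simp_all add: linD s.scale_right_distrib mult.commute s.vector_space_axioms)
qed

lemmas lin_scale = lin_scale_left[OF vector_space_axioms] lin_scale_right[of scale]
  lin_scale_left[OF vector_space_scalars] lin_scale_right[of "(*)"]

lemma lin_counit: "lin scale f \<Longrightarrow> lin (*) (\<lambda>x. counit (f x))"
  by (rule lin_compose[OF counit_linear])

lemma lin_sum_list:
  assumes "vector_space s" "\<And>y. y \<in> set ys \<Longrightarrow> lin s (\<lambda>x. F x y)"
  shows "lin s (\<lambda>x. \<Sum>y\<leftarrow>ys. F x y)"
proof -
  interpret s: vector_space s by fact
  show ?thesis using assms(2)
    by (induction ys) (auto simp: Vector_Spaces.linear_iff vector_space_axioms assms(1)
        algebra_simps s.scale_right_distrib)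
qed

lemma lin_sweedler_fun:
  assumes "\<And>a b. lin s (\<lambda>x. F x a b)"
  shows "lin s (\<lambda>x. sweedler h (F x))"
  unfolding sweedler_def using linD(1)[OF assms] assms
  by (intro lin_sum_list) (auto split: prod.splits)

lemma sweedler_add:
  "bilin s F \<Longrightarrow> sweedler (g + h) F = sweedler g F + sweedler h F"
  using tensor2_eq_sum_list[of scale s F, OF _ _ comult_add[of g h]] by (simp add: sweedler_def)

lemma lin_push_sweedler: "lin s f \<Longrightarrow> f (sweedler h F) = sweedler h (\<lambda>a b. f (F a b))"
  unfolding sweedler_def by (simp add: linD comp_def case_prod_unfold)

lemma vector_space_push_sum:
  assumes "vector_space s"
  shows "s c (\<Sum>x\<leftarrow>xs. f x) = (\<Sum>x\<leftarrow>xs. s c (f x))"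
proof -
  interpret s: vector_space s by fact
  show ?thesis by (induction xs) (simp_all add: s.scale_right_distrib)
qed

lemma scale_push_sweedler: "vector_space s \<Longrightarrow> s c (sweedler h F) = sweedler h (\<lambda>a b. s c (F a b))"
  unfolding sweedler_def by (simp add: vector_space_push_sum case_prod_unfold)

lemma sweedler_cong_tensor:
  "bilin s F \<Longrightarrow> tensor2_eq scale (comult h) t \<Longrightarrow> sweedler h F = (\<Sum>(a, b)\<leftarrow>t. F a b)"
  unfolding sweedler_def by (rule tensor2_eq_sum_list) auto

lemma sweedler_scale:
  assumes "bilin s F"
  shows "sweedler (c *s h) F = s c (sweedler h F)"
proof -
  have "sweedler (c *s h) F = (\<Sum>(a, b)\<leftarrow>[(c *s h1, h2). (h1, h2) \<leftarrow> comult h]. F a b)"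
    by (rule sweedler_cong_tensor[OF assms comult_scale])
  also have "\<dots> = sweedler h (\<lambda>a b. F (c *s a) b)"
    unfolding sweedler_def by (simp add: comp_def case_prod_unfold)
  also have "\<dots> = sweedler h (\<lambda>a b. s c (F a b))"
  proof -
    have "F (c *s a) b = s c (F a b)" for a b
      using assms linD(3)[of s "\<lambda>a. F a b"] by blast
    then show ?thesis by simp
  qed
  finally show ?thesis
    using assms scale_push_sweedler[of s c h F] linD(1) by metis
qed

lemma lin_sweedler_arg:
  assumes "\<And>b. lin s (\<lambda>a. F a b)" "\<And>a. lin s (F a)" "lin scale f"
  shows "lin s (\<lambda>x. sweedler (f x) F)"
  using assms
  by (intro linI) (auto simp: linD(2,3)[OF assms(3)] sweedler_add[of s] sweedler_scale[of s] linD(1)[OF assms(2)])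

lemmas lin_intros = lin_id lin_scale lin_counit lin_sweedler_arg lin_sweedler_fun

lemma sweedler_assoc:
  assumes "\<And>b c. lin s (\<lambda>a. F a b c)" "\<And>a c. lin s (\<lambda>b. F a b c)" "\<And>a b. lin s (F a b)"
  shows "sweedler h (\<lambda>x c. sweedler x (\<lambda>a b. F a b c)) = sweedler h (\<lambda>a y. sweedler y (F a))"
proof -
  have 1: "(\<Sum>(a, b, c)\<leftarrow>[(h11, h12, h2). (h1, h2) \<leftarrow> t, (h11, h12) \<leftarrow> comult h1]. F a b c)
     = (\<Sum>(x, c)\<leftarrow>t. sweedler x (\<lambda>a b. F a b c))" for t
    by (induction t) (auto simp: sweedler_def comp_def case_prod_unfold)
  have 2: "(\<Sum>(a, b, c)\<leftarrow>[(h1, h21, h22). (h1, h2) \<leftarrow> t, (h21, h22) \<leftarrow> comult h2]. F a b c)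
     = (\<Sum>(a, y)\<leftarrow>t. sweedler y (F a))" for t
    by (induction t) (auto simp: sweedler_def comp_def case_prod_unfold)
  show ?thesis
    using tensor3_eq_sum_list[of scale s F, OF assms coassoc[of h]]
    unfolding 1 2 by (simp add: sweedler_def)
qed

lemma sweedler_counit_left: "lin s f \<Longrightarrow> sweedler h (\<lambda>a b. s (counit a) (f b)) = f h"
  using counit_left[of h] lin_push_sweedler[of s f h "\<lambda>a b. counit a *s b"]
  by (simp add: sweedler_def linD)

lemma sweedler_counit_right: "lin s f \<Longrightarrow> sweedler h (\<lambda>a b. s (counit b) (f a)) = f h"
  using counit_right[of h] lin_push_sweedler[of s f h "\<lambda>a b. counit b *s a"]
  by (simp add: sweedler_def linD)

lemma sweedler_swap: "sweedler g (\<lambda>a b. sweedler h (F a b)) = sweedler h (\<lambda>c d. sweedler g (\<lambda>a b. F a b c d))"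
proof -
  have "(\<Sum>x\<leftarrow>xs. \<Sum>y\<leftarrow>ys. G x y) = (\<Sum>y\<leftarrow>ys. \<Sum>x\<leftarrow>xs. G x y)"
    for xs ys and G :: "'h \<times> 'h \<Rightarrow> 'h \<times> 'h \<Rightarrow> 'a"
    by (induction xs) (simp_all add: sum_list_addf)
  then show ?thesis
    unfolding sweedler_def by (simp add: case_prod_unfold)
qed

section \<open>Functionals, projections and equality of tensors\<close>

lemma functional_exists:
  assumes "x \<noteq> 0"
  obtains \<phi> where "lin (*) \<phi>" "\<phi> x = 1"
proof -
  interpret vector_space_pair scale "(*) :: 'k \<Rightarrow> _"
    by (simp add: vector_space_pair_def vector_space_axioms vector_space_scalars)
  from assms have "independent {x}" by simp
  from linear_independent_extend[OF this, of "\<lambda>_. 1"] that show thesis by auto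
qed

lemma projection_exists:
  assumes "subspace D"
  obtains p where "lin scale p" "\<And>x. p x \<in> D" "\<And>x. x \<in> D \<Longrightarrow> p x = x"
proof -
  interpret vector_space_pair scale scale
    by (simp add: vector_space_pair_def vector_space_axioms)
  from linear_exists_left_inverse_on[OF lin_id assms] that show thesis by auto
qed

text \<open>A vector outside the span of the bilinear relations is separated from it by a linear
  functional, and on generators this functional is a bilinear form. This is the converse of
  \<open>tensor2_eq_sum_list\<close> for scalar-valued forms.\<close>

lemma tensor2_eqI:
  assumes "\<And>f. bilin (*) f \<Longrightarrow> (\<Sum>(a, b)\<leftarrow>s. f a b) = (\<Sum>(a, b)\<leftarrow>t. f a b)"
  shows "tensor2_eq scale s t"
proof (rule ccontr)
  let ?u = "formal_sum s - formal_sum t :: 'h \<times> 'h \<Rightarrow>\<^sub>0 'k"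
  assume neg: "\<not> tensor2_eq scale s t"
  interpret free: vector_space "free_scale :: 'k \<Rightarrow> ('h \<times> 'h \<Rightarrow>\<^sub>0 'k) \<Rightarrow> _"
    by (rule vector_space_free)
  interpret P: vector_space_pair "free_scale :: 'k \<Rightarrow> ('h \<times> 'h \<Rightarrow>\<^sub>0 'k) \<Rightarrow> _" "(*) :: 'k \<Rightarrow> _"
    by (simp add: vector_space_pair_def vector_space_free vector_space_scalars)
  from neg have u: "?u \<notin> free.span (bilin_rels scale)" by (simp add: tensor2_eq_def)
  obtain B where B: "B \<subseteq> bilin_rels scale" "free.independent B" "bilin_rels scale \<subseteq> free.span B"
    using free.maximal_independent_subset by blast
  with u free.span_mono[OF B(1)] have "free.independent (insert ?u B)"
    by (intro free.independent_insertI) auto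
  from P.linear_independent_extend[OF this, of "\<lambda>x. if x = ?u then 1 else 0"]
  obtain L where L: "Vector_Spaces.linear free_scale (*) L"
    and LB: "\<forall>x\<in>insert ?u B. L x = (if x = ?u then 1 else 0)" by blast
  interpret L: Vector_Spaces.linear free_scale "(*)" L by fact
  have uB: "?u \<notin> B" using u B free.span_base by blast
  have rel: "L x = 0" if "x \<in> bilin_rels scale" for x
    by (rule L.eq_0_on_span[of B]) (use LB uB B that in auto)
  let ?f = "\<lambda>a b. L (gen (a, b))"
  have "bilin (*) ?f"
  proof (intro conjI allI linI vector_space_scalars)
    fix a a' b c
    have "gen (a + a', b) - gen (a, b) - gen (a', b) \<in> bilin_rels scale"
      "gen (b, a + a') - gen (b, a) - gen (b, a') \<in> bilin_rels scale"
      "gen (c *s a, b) - free_scale c (gen (a, b)) \<in> bilin_rels scale"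
      "gen (b, c *s a) - free_scale c (gen (b, a)) \<in> bilin_rels scale"
      unfolding bilin_rels_def by blast+
    from this[THEN rel] show "?f (a + a') b = ?f a b + ?f a' b" "?f b (a + a') = ?f b a + ?f b a'"
      "?f (c *s a) b = c * ?f a b" "?f b (c *s a) = c * ?f b a"
      by (simp_all add: L.diff L.scale diff_eq_eq)
  qed
  from assms[OF this] have "(\<Sum>x\<leftarrow>s. L (gen x)) = (\<Sum>x\<leftarrow>t. L (gen x))"
    by (simp add: case_prod_unfold)
  moreover have "L (formal_sum r) = (\<Sum>x\<leftarrow>r. L (gen x))" for r
    unfolding formal_sum_def by (induction r) (simp_all add: L.add L.zero)
  ultimately have "L ?u = 0" by (simp add: L.diff)
  then show False using LB by simp
qed

text \<open>Expand the second components in a basis of the whole space. The coordinate functionals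
  are admissible choices of \<open>\<psi>\<close>, so the total first component attached to each
  basis vector vanishes.\<close>

lemma functional_separates_tensor:
  assumes "\<And>\<psi>. lin (*) \<psi> \<Longrightarrow> (\<Sum>(a, b)\<leftarrow>t. \<psi> b *s a) = 0" and "bilin (*) f"
  shows "(\<Sum>(a, b)\<leftarrow>t. f a b) = 0"
proof -
  define B where "B = extend_basis {}"
  have B: "independent B" "span B = UNIV"
    by (simp_all add: B_def independent_extend_basis span_extend_basis independent_empty)
  define E where "E = (\<Union>(a, b)\<in>set t. {e. representation B b e \<noteq> 0})"
  have E: "finite E" unfolding E_def by (auto simp: finite_representation)
  have b: "(\<Sum>e\<in>E. representation B b e *s e) = b" if "(a, b) \<in> set t" for a b
  proof -
    have "(\<Sum>e\<in>E. representation B b e *s e)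
        = (\<Sum>e | representation B b e \<noteq> 0. representation B b e *s e)"
      using E that by (intro sum.mono_neutral_right) (auto simp: E_def)
    also have "\<dots> = b" using B by (intro sum_nonzero_representation_eq) auto
    finally show ?thesis .
  qed
  have "(\<Sum>(a, b)\<leftarrow>t. f a b) = (\<Sum>(a, b)\<leftarrow>t. \<Sum>e\<in>E. representation B b e * f a e)"
  proof (intro arg_cong[of _ _ sum_list] map_cong refl, clarify)
    fix a b assume ab: "(a, b) \<in> set t"
    interpret Vector_Spaces.linear scale "(*)" "f a" using assms(2) by blast
    show "f a b = (\<Sum>e\<in>E. representation B b e * f a e)"
      using arg_cong[OF b[OF ab], of "f a"] by (simp add: sum scale)
  qed
  also have "\<dots> = (\<Sum>e\<in>E. \<Sum>(a, b)\<leftarrow>t. representation B b e * f a e)"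
    by (induction t) (auto simp: sum.distrib)
  also have "\<dots> = (\<Sum>e\<in>E. f (\<Sum>(a, b)\<leftarrow>t. representation B b e *s a) e)"
  proof (intro sum.cong refl)
    fix e
    have le: "lin (*) (\<lambda>a. f a e)" using assms(2) by blast
    show "(\<Sum>(a, b)\<leftarrow>t. representation B b e * f a e) = f (\<Sum>(a, b)\<leftarrow>t. representation B b e *s a) e"
      by (simp add: linD(6)[OF le] linD(3)[OF le] comp_def case_prod_unfold)
  qed
  also have "\<dots> = 0"
  proof (intro sum.neutral ballI)
    fix e
    have "lin (*) (\<lambda>b. representation B b e)"
      using B by (intro linI vector_space_scalars) (simp_all add: representation_add representation_scale)
    moreover have "lin (*) (\<lambda>a. f a e)" using assms(2) by blast
    ultimately show "f (\<Sum>(a, b)\<leftarrow>t. representation B b e *s a) e = 0"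
      using assms(1) linD(4)[of "(*)" "\<lambda>a. f a e"] by simp
  qed
  finally show ?thesis .
qed

lemma bilin_lin:
  assumes "bilin s F" "lin scale f"
  shows "lin s (\<lambda>x. F (f x) b)" "lin s (\<lambda>x. F a (f x))"
  using assms lin_compose[of s "\<lambda>a. F a b" f] lin_compose[of s "F a" f] by auto

lemma bilinI:
  assumes "\<And>b. lin s (\<lambda>a. F a b)" "\<And>a. lin s (F a)"
  shows "bilin s F"
  using assms by blast

lemma subspace_sum_list:
  assumes "subspace D" "\<And>x. x \<in> set xs \<Longrightarrow> f x \<in> D"
  shows "(\<Sum>x\<leftarrow>xs. f x) \<in> D"
  using assms(2) by (induction xs) (auto simp: subspace_0 subspace_add assms(1))

lemma sweedler_in_subspace:
  assumes "subspace D" "\<And>a b. F a b \<in> D"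
  shows "sweedler h F \<in> D"
  unfolding sweedler_def using assms by (intro subspace_sum_list) auto

lemma subcoalgebra_comult:
  assumes "subcoalgebra D" "d \<in> D"
  obtains t where "set t \<subseteq> D \<times> D" "tensor2_eq scale (comult d) t"
  using assms unfolding subcoalgebra_def by blast

lemma lin_diff: "lin s f \<Longrightarrow> lin s g \<Longrightarrow> lin s (\<lambda>x. f x - g x)"
proof -
  assume f: "lin s f" and g: "lin s g"
  interpret s: vector_space s using f by (rule linD)
  show ?thesis
    using f g by (intro linI) (simp_all add: linD s.scale_right_diff_distrib s.vector_space_axioms)
qed

lemma sweedler_diff: "sweedler h (\<lambda>a b. F a b - G a b) = sweedler h F - sweedler h G"
proof -
  have "(\<Sum>x\<leftarrow>xs. f x - g x) = (\<Sum>x\<leftarrow>xs. f x) - (\<Sum>x\<leftarrow>xs. g x)"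
    for xs and f g :: "'h \<times> 'h \<Rightarrow> 'a"
    by (induction xs) simp_all
  then show ?thesis by (simp add: sweedler_def case_prod_unfold)
qed

text \<open>
  The right-hand side says that \<open>D\<close> is a sub-bimodule of \<open>H\<close> over the dual algebra \<open>H\<^sup>*\<close>, which makes
  closure under intersections, sums and unions of chains evident.
\<close>

lemma subcoalgebra_iff:
  "subcoalgebra D \<longleftrightarrow> subspace D \<and>
     (\<forall>\<phi> d. lin (*) \<phi> \<longrightarrow> d \<in> D \<longrightarrow> sweedler d (\<lambda>a b. \<phi> a *s b) \<in> D \<and> sweedler d (\<lambda>a b. \<phi> b *s a) \<in> D)"
  (is "_ \<longleftrightarrow> ?R")
proof
  assume D: "subcoalgebra D"
  then have sub: "subspace D" by (simp add: subcoalgebra_def)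
  have "sweedler d (\<lambda>a b. \<phi> a *s b) \<in> D \<and> sweedler d (\<lambda>a b. \<phi> b *s a) \<in> D"
    if \<phi>: "lin (*) \<phi>" and d: "d \<in> D" for \<phi> d
  proof -
    obtain t where t: "set t \<subseteq> D \<times> D" "tensor2_eq scale (comult d) t"
      using subcoalgebra_comult[OF D d] .
    have "sweedler d (\<lambda>a b. \<phi> a *s b) = (\<Sum>(a, b)\<leftarrow>t. \<phi> a *s b)"
      by (intro sweedler_cong_tensor[of scale, OF _ t(2)] bilinI lin_intros \<phi>)
    moreover have "sweedler d (\<lambda>a b. \<phi> b *s a) = (\<Sum>(a, b)\<leftarrow>t. \<phi> b *s a)"
      by (intro sweedler_cong_tensor[of scale, OF _ t(2)] bilinI lin_intros \<phi>)
    ultimately show ?thesis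
      using t(1) by (auto intro!: subspace_sum_list sub subspace_scale)
  qed
  with sub show ?R by blast
next
  assume R: ?R
  then have sub: "subspace D" by blast
  obtain p where p: "lin scale p" "\<And>x. p x \<in> D" "\<And>x. x \<in> D \<Longrightarrow> p x = x"
    using projection_exists[OF sub] by blast
  have "\<exists>t. set t \<subseteq> D \<times> D \<and> tensor2_eq scale (comult d) t" if d: "d \<in> D" for d
  proof (intro exI conjI tensor2_eqI)
    \<comment> \<open>The witness is \<open>(p \<otimes> p)\<Delta>(d)\<close>, reached by
      projecting one leg at a time: contractions of \<open>\<Delta>(d)\<close> lie in
      \<open>D\<close> and are fixed by \<open>p\<close>, so the differences \<open>a - p a\<close>
      and \<open>b - p b\<close> contribute 0.\<close>
    let ?t = "map (\<lambda>(a, b). (p a, p b)) (comult d)"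
    show "set ?t \<subseteq> D \<times> D" using p by auto
    fix f assume f: "bilin (*) f"
    have "(\<Sum>(x, y)\<leftarrow>map (\<lambda>(a, b). (a - p a, b)) (comult d). f x y) = 0"
    proof (rule functional_separates_tensor[OF _ f])
      fix \<psi> assume \<psi>: "lin (*) \<psi>"
      have "(\<Sum>(x, y)\<leftarrow>map (\<lambda>(a, b). (a - p a, b)) (comult d). \<psi> y *s x)
        = sweedler d (\<lambda>a b. \<psi> b *s a) - sweedler d (\<lambda>a b. \<psi> b *s p a)"
        by (subst sweedler_diff[symmetric])
          (simp add: sweedler_def comp_def case_prod_unfold scale_right_diff_distrib)
      also have "sweedler d (\<lambda>a b. \<psi> b *s p a) = p (sweedler d (\<lambda>a b. \<psi> b *s a))"
        using p(1) by (simp add: lin_push_sweedler linD)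
      finally show "(\<Sum>(x, y)\<leftarrow>map (\<lambda>(a, b). (a - p a, b)) (comult d). \<psi> y *s x) = 0"
        using R \<psi> d by (simp add: p(3))
    qed
    moreover have "f (a - p a) b = f a b - f (p a) b" for a b
      using f linD(5)[of "(*)" "\<lambda>a. f a b"] by blast
    ultimately have 1: "sweedler d f = sweedler d (\<lambda>a b. f (p a) b)"
      using f sweedler_diff[of d f "\<lambda>a b. f (p a) b"]
      by (simp add: sweedler_def comp_def case_prod_unfold)
    have f': "bilin (*) (\<lambda>y x. f (p x) y)"
      by (intro bilinI bilin_lin[OF f] lin_intros p(1))
    have "(\<Sum>(y, x)\<leftarrow>map (\<lambda>(a, b). (b - p b, a)) (comult d). f (p x) y) = 0"
    proof (rule functional_separates_tensor[OF _ f'])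
      fix \<psi> assume \<psi>: "lin (*) \<psi>"
      have "(\<Sum>(x, y)\<leftarrow>map (\<lambda>(a, b). (b - p b, a)) (comult d). \<psi> y *s x)
        = sweedler d (\<lambda>a b. \<psi> a *s b) - sweedler d (\<lambda>a b. \<psi> a *s p b)"
        by (subst sweedler_diff[symmetric])
          (simp add: sweedler_def comp_def case_prod_unfold scale_right_diff_distrib)
      also have "sweedler d (\<lambda>a b. \<psi> a *s p b) = p (sweedler d (\<lambda>a b. \<psi> a *s b))"
        using p(1) by (simp add: lin_push_sweedler linD)
      finally show "(\<Sum>(x, y)\<leftarrow>map (\<lambda>(a, b). (b - p b, a)) (comult d). \<psi> y *s x) = 0"
        using R \<psi> d by (simp add: p(3))
    qed
    moreover have "f (p a) (b - p b) = f (p a) b - f (p a) (p b)" for a b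
      using f linD(5)[of "(*)" "f (p a)"] by blast
    ultimately have 2: "sweedler d (\<lambda>a b. f (p a) b) = sweedler d (\<lambda>a b. f (p a) (p b))"
      using f sweedler_diff[of d "\<lambda>a b. f (p a) b" "\<lambda>a b. f (p a) (p b)"]
      by (simp add: sweedler_def comp_def case_prod_unfold)
    show "(\<Sum>(a, b)\<leftarrow>comult d. f a b) = (\<Sum>(a, b)\<leftarrow>?t. f a b)"
      using 1 2 by (simp add: sweedler_def comp_def case_prod_unfold)
  qed
  with sub show "subcoalgebra D" by (auto simp: subcoalgebra_def)
qed

section \<open>Operations on subcoalgebras, and simple ones\<close>

lemma subcoalgebra_subspace: "subcoalgebra D \<Longrightarrow> subspace D"
  by (simp add: subcoalgebra_def)

lemma subcoalgebra_zero: "subcoalgebra {0}"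
  unfolding subcoalgebra_def
proof (intro conjI ballI exI)
  show "tensor2_eq scale (comult d) []" if "d \<in> {0}" for d
  proof (rule tensor2_eqI)
    fix f assume "bilin (*) f"
    from sweedler_scale[OF this, of 0 d] that show "(\<Sum>(a, b)\<leftarrow>comult d. f a b) = (\<Sum>(a, b)\<leftarrow>[]. f a b)"
      by (simp add: sweedler_def)
  qed
qed auto

lemma subcoalgebra_Int: "subcoalgebra D \<Longrightarrow> subcoalgebra E \<Longrightarrow> subcoalgebra (D \<inter> E)"
  by (simp add: subcoalgebra_iff subspace_inter)

lemma subcoalgebra_sum:
  assumes "subcoalgebra D" "subcoalgebra E"
  shows "subcoalgebra {x + y |x y. x \<in> D \<and> y \<in> E}" (is "subcoalgebra ?S")
  unfolding subcoalgebra_iff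
proof (intro conjI allI impI)
  show "subspace ?S"
    using assms by (intro subspace_sums subcoalgebra_subspace)
  fix \<phi> d assume \<phi>: "lin (*) \<phi>" and "d \<in> ?S"
  then obtain x y where d: "d = x + y" and xy: "x \<in> D" "y \<in> E" by blast
  have "sweedler d (\<lambda>a b. \<phi> a *s b) = sweedler x (\<lambda>a b. \<phi> a *s b) + sweedler y (\<lambda>a b. \<phi> a *s b)"
    unfolding d by (intro sweedler_add[of scale] bilinI lin_intros \<phi>)
  then show "sweedler d (\<lambda>a b. \<phi> a *s b) \<in> ?S"
    using assms \<phi> xy unfolding subcoalgebra_iff by blast
  have "sweedler d (\<lambda>a b. \<phi> b *s a) = sweedler x (\<lambda>a b. \<phi> b *s a) + sweedler y (\<lambda>a b. \<phi> b *s a)"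
    unfolding d by (intro sweedler_add[of scale] bilinI lin_intros \<phi>)
  then show "sweedler d (\<lambda>a b. \<phi> b *s a) \<in> ?S"
    using assms \<phi> xy unfolding subcoalgebra_iff by blast
qed

lemma subcoalgebra_span_Union:
  assumes "\<And>D. D \<in> \<D> \<Longrightarrow> subcoalgebra D"
  shows "subcoalgebra (span (\<Union>\<D>))" (is "subcoalgebra ?S")
  unfolding subcoalgebra_iff
proof (intro conjI allI impI)
  show "subspace ?S" by simp
  fix \<phi> d assume \<phi>: "lin (*) \<phi>" and d: "d \<in> ?S"
  have l: "lin scale (\<lambda>x. sweedler x (\<lambda>a b. \<phi> a *s b))" "lin scale (\<lambda>x. sweedler x (\<lambda>a b. \<phi> b *s a))"
    by (intro lin_intros \<phi>)+
  have "subspace {x. sweedler x (\<lambda>a b. \<phi> a *s b) \<in> ?S}" "subspace {x. sweedler x (\<lambda>a b. \<phi> b *s a) \<in> ?S}"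
    using l[THEN linD(2)] l[THEN linD(3)] l[THEN linD(4)]
    by (auto simp: subspace_def span_add span_scale span_zero)
  moreover have "sweedler x (\<lambda>a b. \<phi> a *s b) \<in> ?S \<and> sweedler x (\<lambda>a b. \<phi> b *s a) \<in> ?S"
    if "x \<in> D" "D \<in> \<D>" for x D
    using assms[OF that(2)] that \<phi> unfolding subcoalgebra_iff by (meson UnionI span_base)
  ultimately have "?S \<subseteq> {x. sweedler x (\<lambda>a b. \<phi> a *s b) \<in> ?S}"
    "?S \<subseteq> {x. sweedler x (\<lambda>a b. \<phi> b *s a) \<in> ?S}"
    by (intro span_minimal; auto)+
  then show "sweedler d (\<lambda>a b. \<phi> a *s b) \<in> ?S" "sweedler d (\<lambda>a b. \<phi> b *s a) \<in> ?S"
    using d by auto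
qed

text \<open>Zorn's lemma applies because stability under contractions passes to unions of nonempty
  chains, and \<open>{0}\<close> avoids \<open>x\<close>. A general \<open>x\<close> serves to find
  simple subcoalgebras, \<open>x = 1\<close> to find the complement of \<open>k1\<close>.\<close>

lemma subcoalgebra_maximal_avoiding:
  assumes "subcoalgebra K" "x \<noteq> 0"
  obtains N where "subcoalgebra N" "N \<subseteq> K" "x \<notin> N"
    "\<And>M. subcoalgebra M \<Longrightarrow> M \<subseteq> K \<Longrightarrow> N \<subset> M \<Longrightarrow> x \<in> M"
proof -
  define A where "A = {N. subcoalgebra N \<and> N \<subseteq> K \<and> x \<notin> N}"
  have "\<exists>N\<in>A. \<forall>M\<in>A. N \<subseteq> M \<longrightarrow> M = N"
  proof (rule subset_Zorn_nonempty)
    have "0 \<in> K" using assms(1) by (simp add: subspace_0 subcoalgebra_subspace)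
    then have "{0} \<in> A" using assms(2) by (auto simp: A_def subcoalgebra_zero)
    then show "A \<noteq> {}" by blast
    fix \<C> assume ne: "\<C> \<noteq> {}" and chain: "subset.chain A \<C>"
    then have C: "\<And>N. N \<in> \<C> \<Longrightarrow> subcoalgebra N \<and> N \<subseteq> K \<and> x \<notin> N"
      by (auto simp: subset.chain_def A_def)
    have "subspace (\<Union>\<C>)"
    proof (rule subspaceI)
      show "0 \<in> \<Union>\<C>" using C ne by (auto simp: subcoalgebra_subspace subspace_0)
      show "c *s y \<in> \<Union>\<C>" if "y \<in> \<Union>\<C>" for c y
        using that C subspace_scale subcoalgebra_subspace by blast
      fix y z assume "y \<in> \<Union>\<C>" "z \<in> \<Union>\<C>"
      then obtain M N where MN: "M \<in> \<C>" "N \<in> \<C>" "y \<in> M" "z \<in> N" by blast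
      then have "M \<subseteq> N \<or> N \<subseteq> M"
        using chain by (auto simp: subset.chain_def)
      with MN C show "y + z \<in> \<Union>\<C>"
        by (meson UnionI subcoalgebra_subspace subsetD subspace_add)
    qed
    then have "subcoalgebra (\<Union>\<C>)"
      using C unfolding subcoalgebra_iff by blast
    with C show "\<Union>\<C> \<in> A" by (auto simp: A_def)
  qed
  then obtain N where N: "N \<in> A" "\<And>M. M \<in> A \<Longrightarrow> N \<subseteq> M \<Longrightarrow> M = N" by blast
  show thesis
  proof (rule that)
    show "subcoalgebra N" "N \<subseteq> K" "x \<notin> N" using N(1) by (auto simp: A_def)
    show "x \<in> M" if "subcoalgebra M" "M \<subseteq> K" "N \<subset> M" for M
      using N(2)[of M] that by (auto simp: A_def)
  qed
qed

text \<open>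
  If \<open>N\<close> is maximal among the subcoalgebras of \<open>K\<close> avoiding some \<open>x \<noteq> 0\<close>, then a complement of \<open>N\<close> in
  \<open>K\<close> is simple.
\<close>

lemma simple_subcoalgebra_exists:
  assumes compl: "\<And>D. subcoalgebra D \<Longrightarrow>
      \<exists>E. subcoalgebra E \<and> D \<inter> E = {0} \<and> (\<forall>x. \<exists>d\<in>D. \<exists>e\<in>E. x = d + e)"
    and K: "subcoalgebra K" "K \<noteq> {0}"
  obtains M where "simple_subcoalgebra M" "M \<subseteq> K"
proof -
  \<comment> \<open>Complements relativize by the modular law: a complement of \<open>D\<close> in
    the whole space meets \<open>L\<close> in a complement of \<open>D\<close> in
    \<open>L\<close>.\<close>
  have rel: "\<exists>E. subcoalgebra E \<and> E \<subseteq> L \<and> D \<inter> E = {0} \<and> (\<forall>x\<in>L. \<exists>d\<in>D. \<exists>e\<in>E. x = d + e)"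
    if D: "subcoalgebra D" and L: "subcoalgebra L" and DL: "D \<subseteq> L" for D L
  proof -
    from compl[OF D] obtain E where E: "subcoalgebra E" "D \<inter> E = {0}"
      "\<forall>x. \<exists>d\<in>D. \<exists>e\<in>E. x = d + e" by (elim exE conjE)
    have "\<exists>d\<in>D. \<exists>e\<in>E \<inter> L. x = d + e" if x: "x \<in> L" for x
    proof -
      from E(3) obtain d e where de: "d \<in> D" "e \<in> E" "x = d + e" by blast
      then have "e = x - d" by simp
      moreover have "x - d \<in> L"
        using x de DL L by (intro subspace_diff subcoalgebra_subspace) auto
      ultimately have "e \<in> L" by simp
      with de show ?thesis by blast
    qed
    moreover have "0 \<in> L" using L by (simp add: subspace_0 subcoalgebra_subspace)
    ultimately show ?thesis
      using E L by (intro exI[of _ "E \<inter> L"]) (auto simp: subcoalgebra_Int)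
  qed
  have zero: "0 \<in> D" if "subcoalgebra D" for D
    using that by (simp add: subspace_0 subcoalgebra_subspace)
  from K zero[OF K(1)] obtain x where x: "x \<in> K" "x \<noteq> 0" by blast
  obtain N where N: "subcoalgebra N" "N \<subseteq> K" "x \<notin> N"
    "\<And>M. subcoalgebra M \<Longrightarrow> M \<subseteq> K \<Longrightarrow> N \<subset> M \<Longrightarrow> x \<in> M"
    using subcoalgebra_maximal_avoiding[OF K(1) x(2)] by blast
  from rel[OF N(1) K(1) N(2)] obtain M where M: "subcoalgebra M" "M \<subseteq> K" "N \<inter> M = {0}"
    "\<forall>x\<in>K. \<exists>d\<in>N. \<exists>e\<in>M. x = d + e" by (elim exE conjE)
  \<comment> \<open>\<open>N + E\<close> is strictly larger than \<open>N\<close>, since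
    \<open>E\<close> meets \<open>N\<close> only in 0; by maximality it contains
    \<open>x\<close>.\<close>
  have absorb: "\<exists>n\<in>N. \<exists>e\<in>E. x = n + e" if E: "subcoalgebra E" "E \<subseteq> M" "E \<noteq> {0}" for E
  proof -
    from E(3) zero[OF E(1)] obtain e where e: "e \<in> E" "e \<noteq> 0" by blast
    with M(3) E(2) have "e \<notin> N" by blast
    moreover have "0 + e \<in> {n + e |n e. n \<in> N \<and> e \<in> E}"
      using zero[OF N(1)] e by blast
    moreover have "N \<subseteq> {n + e |n e. n \<in> N \<and> e \<in> E}"
    proof
      fix n assume "n \<in> N"
      then have "n + 0 \<in> {n + e |n e. n \<in> N \<and> e \<in> E}" using zero[OF E(1)] by blast
      then show "n \<in> {n + e |n e. n \<in> N \<and> e \<in> E}" by simp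
    qed
    ultimately have "N \<subset> {n + e |n e. n \<in> N \<and> e \<in> E}" by auto
    moreover have "{n + e |n e. n \<in> N \<and> e \<in> E} \<subseteq> K"
      using N(2) E(2) M(2) K(1) by (auto intro!: subspace_add subcoalgebra_subspace)
    ultimately have "x \<in> {n + e |n e. n \<in> N \<and> e \<in> E}"
      using N(4)[OF subcoalgebra_sum[OF N(1) E(1)]] by blast
    then show ?thesis by blast
  qed
  have "simple_subcoalgebra M"
    unfolding simple_subcoalgebra_def
  proof (intro conjI allI impI)
    show "M \<noteq> {0}" using M(4) x(1) N(3) by auto
    fix E assume "subcoalgebra E \<and> E \<subseteq> M"
    then have E: "subcoalgebra E" "E \<subseteq> M" by auto
    from rel[OF E(1) M(1) E(2)] obtain F where F: "subcoalgebra F" "F \<subseteq> M" "E \<inter> F = {0}"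
      "\<forall>x\<in>M. \<exists>d\<in>E. \<exists>e\<in>F. x = d + e" by (elim exE conjE)
    show "E = {0} \<or> E = M"
    \<comment> \<open>Two nonzero complementary parts \<open>E\<close>, \<open>F\<close> of
      \<open>M\<close> would give \<open>x = n + e = n' + f\<close>. Then
      \<open>n - n' = f - e\<close> lies in \<open>N \<inter> M = {0}\<close>, so
      \<open>e = f\<close> lies in \<open>E \<inter> F = {0}\<close> and \<open>x\<close> is in
      \<open>N\<close>.\<close>
    proof (rule ccontr)
      assume neg: "\<not> ?thesis"
      then have "F \<noteq> {0}" using F(4) E(2) by auto
      from absorb[OF F(1,2) this] absorb[OF E] neg obtain n n' e f
        where *: "n \<in> N" "n' \<in> N" "e \<in> E" "f \<in> F" "x = n + e" "x = n' + f" by blast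
      have "n - n' \<in> N" using * N(1) by (auto intro: subspace_diff subcoalgebra_subspace)
      moreover have "f - e \<in> M"
        using * E(2) F(2) M(1) by (auto intro: subspace_diff subcoalgebra_subspace)
      moreover have "n - n' = f - e" using * by (simp add: algebra_simps)
      ultimately have "f - e \<in> N \<inter> M" by simp
      then have "f - e = 0" unfolding M(3) by simp
      then have "e \<in> E \<inter> F" using * by simp
      then have "x = n" using * F(3) by simp
      with * N(3) show False by simp
    qed
  qed (rule M(1))
  with M(2) show thesis using that by blast
qed

text \<open>A nonzero complement of the sum of all simple subcoalgebras would contain a simple one,
  which also lies in that sum and hence in the zero intersection.\<close>

lemma cosemisimpleI:
  assumes compl: "\<And>D. subcoalgebra D \<Longrightarrow>
      \<exists>E. subcoalgebra E \<and> D \<inter> E = {0} \<and> (\<forall>x. \<exists>d\<in>D. \<exists>e\<in>E. x = d + e)"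
  shows cosemisimple
proof -
  let ?C = "span (\<Union>{D. simple_subcoalgebra D})"
  have "subcoalgebra ?C"
    by (rule subcoalgebra_span_Union) (simp add: simple_subcoalgebra_def)
  from compl[OF this] obtain K where K: "subcoalgebra K" "?C \<inter> K = {0}"
    "\<forall>x. \<exists>d\<in>?C. \<exists>e\<in>K. x = d + e" by (elim exE conjE)
  have "K = {0}"
  proof (rule ccontr)
    assume "K \<noteq> {0}"
    from simple_subcoalgebra_exists[OF compl K(1) this]
    obtain M where M: "simple_subcoalgebra M" "M \<subseteq> K" by blast
    then have "M \<subseteq> ?C" by (auto intro: span_base)
    with M K(2) have "M \<subseteq> {0}" by blast
    moreover have "0 \<in> M"
      using M by (simp add: simple_subcoalgebra_def subspace_0 subcoalgebra_subspace)
    ultimately show False using M by (auto simp: simple_subcoalgebra_def)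
  qed
  with K(3) have "x \<in> ?C" for x by auto
  then show ?thesis by (auto simp: cosemisimple_def)
qed

text \<open>Some representative of \<open>\<Delta>(d)\<close> has all components in
  \<open>D\<close>, and bilinear sums may be computed with it, whatever the entries of
  \<open>comult d\<close> are.\<close>

lemma sweedler_cong_subcoalgebra:
  assumes "subcoalgebra D" "d \<in> D" "bilin s F" "bilin s G"
    and "\<And>a b. a \<in> D \<Longrightarrow> b \<in> D \<Longrightarrow> F a b = G a b"
  shows "sweedler d F = sweedler d G"
proof -
  obtain t where t: "set t \<subseteq> D \<times> D" "tensor2_eq scale (comult d) t"
    using subcoalgebra_comult[OF assms(1,2)] .
  have "(\<Sum>(a, b)\<leftarrow>t. F a b) = (\<Sum>(a, b)\<leftarrow>t. G a b)"
    using t(1) assms(5) by (intro arg_cong[of _ _ sum_list] map_cong) auto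
  then show ?thesis
    using sweedler_cong_tensor[OF assms(3) t(2)] sweedler_cong_tensor[OF assms(4) t(2)] by simp
qed

section \<open>Coseparability and averaged projections\<close>

lemma scale_sweedler: "c *s sweedler h F = sweedler h (\<lambda>a b. c *s F a b)"
  by (rule scale_push_sweedler[OF vector_space_axioms])

lemma times_sweedler: "c * sweedler h F = sweedler h (\<lambda>a b. c * F a b)" for c :: 'k
  by (rule scale_push_sweedler[OF vector_space_scalars])

lemma sweedler_scale_vec: "sweedler h F *s v = sweedler h (\<lambda>a b. F a b *s v)"
proof -
  have "sum_list (map f xs) *s v = (\<Sum>x\<leftarrow>xs. f x *s v)" for xs and f :: "'h \<times> 'h \<Rightarrow> 'k"
    by (induction xs) (simp_all add: scale_left_distrib)
  then show ?thesis by (simp add: sweedler_def case_prod_unfold)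
qed

text \<open>
  A form \<open>\<tau>\<close> as below makes the coalgebra coseparable: an arbitrary linear projection \<open>p\<close> onto a
  subcoalgebra is averaged to the left colinear projection \<open>h \<mapsto> \<tau>(h\<^sub>1, p(h\<^sub>2)\<^sub>1)p(h\<^sub>2)\<^sub>2\<close>, and averaging
  once more on the right makes it bicolinear, so its kernel is a complementary subcoalgebra.
\<close>

context
  fixes \<tau> :: "'h \<Rightarrow> 'h \<Rightarrow> 'k"
  assumes \<tau>: "bilin (*) \<tau>"
    and \<tau>_counit: "\<And>h. sweedler h \<tau> = counit h"
    and \<tau>_comult: "\<And>g h. sweedler h (\<lambda>a b. \<tau> b g *s a) = sweedler g (\<lambda>a b. \<tau> h a *s b)"
begin

text \<open>Balancedness of \<open>\<tau>\<close> tested on functionals: a contraction moves from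
  one argument of \<open>\<tau>\<close> to the other, which is what makes averaged maps
  colinear.\<close>

lemma \<tau>_functional:
  assumes "lin (*) \<phi>"
  shows "sweedler g (\<lambda>a b. \<tau> h a * \<phi> b) = sweedler h (\<lambda>a b. \<tau> b g * \<phi> a)"
  using arg_cong[OF \<tau>_comult[of h g], of \<phi>] by (simp add: lin_push_sweedler[OF assms] linD[OF assms])

lemma left_colinear_projection:
  assumes D: "subcoalgebra D"
  obtains P where "lin scale P" "\<And>x. P x \<in> D" "\<And>x. x \<in> D \<Longrightarrow> P x = x"
    "\<And>\<phi> h. lin (*) \<phi> \<Longrightarrow> P (sweedler h (\<lambda>a b. \<phi> a *s b)) = sweedler (P h) (\<lambda>a b. \<phi> a *s b)"
proof -
  obtain p where p: "lin scale p" "\<And>x. p x \<in> D" "\<And>x. x \<in> D \<Longrightarrow> p x = x"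
    using projection_exists[OF subcoalgebra_subspace[OF D]] by blast
  note ls = lin_intros bilin_lin[OF \<tau>] lin_compose[OF p(1)]
  define P where "P h = sweedler h (\<lambda>a b. sweedler (p b) (\<lambda>x y. \<tau> a x *s y))" for h
  have "lin scale P" unfolding P_def by (intro ls)
  moreover have "P h \<in> D" for h
  proof -
    have "sweedler (p b) (\<lambda>x y. \<tau> a x *s y) \<in> D" for a b
      using D bilin_lin(2)[OF \<tau> lin_id, of a] p(2)[of b] by (auto simp: subcoalgebra_iff)
    then show ?thesis
      unfolding P_def by (rule sweedler_in_subspace[OF subcoalgebra_subspace[OF D]])
  qed
  moreover have "P h = h" if h: "h \<in> D" for h
  proof -
    \<comment> \<open>Here the components may be taken in \<open>D\<close>, where \<open>p\<close>
      is the identity; the averaging collapses to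
      \<open>\<tau>(h\<^sub>1, h\<^sub>2)h\<^sub>3 = h\<close>.\<close>
    have "P h = sweedler h (\<lambda>a b. sweedler b (\<lambda>x y. \<tau> a x *s y))"
      unfolding P_def
      by (rule sweedler_cong_subcoalgebra[OF D h, of scale]) (intro bilinI ls | simp add: p(3))+
    also have "\<dots> = sweedler h (\<lambda>w y. sweedler w (\<lambda>a x. \<tau> a x *s y))"
      by (intro sweedler_assoc[symmetric, of scale] ls)
    also have "\<dots> = sweedler h (\<lambda>w y. counit w *s y)"
      by (simp add: sweedler_scale_vec[symmetric] \<tau>_counit)
    also have "\<dots> = h" by (rule sweedler_counit_left[OF lin_id])
    finally show ?thesis .
  qed
  moreover have "P (sweedler h (\<lambda>a b. \<phi> a *s b)) = sweedler (P h) (\<lambda>a b. \<phi> a *s b)" if \<phi>: "lin (*) \<phi>" for \<phi> h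
  proof -
    note ls = ls lin_compose[OF \<phi>]
    have L: "lin scale (\<lambda>h. sweedler h (\<lambda>a b. \<phi> a *s b))" by (intro ls)
    have "sweedler (P h) (\<lambda>a b. \<phi> a *s b)
        = sweedler h (\<lambda>a b. sweedler (p b) (\<lambda>x z. sweedler z (\<lambda>y c. (\<tau> a x * \<phi> y) *s c)))"
      unfolding P_def by (simp add: lin_push_sweedler[OF L] linD(3)[OF L] scale_sweedler)
    also have "\<dots> = sweedler h (\<lambda>a b. sweedler (p b) (\<lambda>w c. sweedler w (\<lambda>x y. (\<tau> a x * \<phi> y) *s c)))"
      by (subst sweedler_assoc[of scale]) (intro ls refl)+
    also have "\<dots> = sweedler h (\<lambda>z b. sweedler (p b) (\<lambda>w c. sweedler z (\<lambda>a a'. (\<tau> a' w * \<phi> a) *s c)))"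
      by (simp add: sweedler_scale_vec[symmetric] \<tau>_functional[OF \<phi>])
    also have "\<dots> = sweedler h (\<lambda>z b. sweedler z (\<lambda>a a'. sweedler (p b) (\<lambda>w c. (\<tau> a' w * \<phi> a) *s c)))"
      by (subst sweedler_swap) (rule refl)
    also have "\<dots> = sweedler h (\<lambda>a z. sweedler z (\<lambda>a' b. sweedler (p b) (\<lambda>w c. (\<tau> a' w * \<phi> a) *s c)))"
      by (intro sweedler_assoc[of scale] ls)
    also have "\<dots> = sweedler h (\<lambda>a z. \<phi> a *s P z)"
      unfolding P_def by (simp add: scale_sweedler mult.commute)
    also have "\<dots> = P (sweedler h (\<lambda>a b. \<phi> a *s b))"
      using \<open>lin scale P\<close> by (simp add: lin_push_sweedler linD(3))
    finally show ?thesis ..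
  qed
  ultimately show thesis by (rule that)
qed

lemma bicolinear_projection:
  assumes D: "subcoalgebra D"
  obtains Q where "lin scale Q" "\<And>x. Q x \<in> D" "\<And>x. x \<in> D \<Longrightarrow> Q x = x"
    "\<And>\<phi> h. lin (*) \<phi> \<Longrightarrow> Q (sweedler h (\<lambda>a b. \<phi> a *s b)) = sweedler (Q h) (\<lambda>a b. \<phi> a *s b)"
    "\<And>\<phi> h. lin (*) \<phi> \<Longrightarrow> Q (sweedler h (\<lambda>a b. \<phi> b *s a)) = sweedler (Q h) (\<lambda>a b. \<phi> b *s a)"
proof -
  obtain P where P: "lin scale P" "\<And>x. P x \<in> D" "\<And>x. x \<in> D \<Longrightarrow> P x = x"
    "\<And>\<phi> h. lin (*) \<phi> \<Longrightarrow> P (sweedler h (\<lambda>a b. \<phi> a *s b)) = sweedler (P h) (\<lambda>a b. \<phi> a *s b)"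
    by (rule left_colinear_projection[OF D]) (rule that)
  note ls = lin_intros bilin_lin[OF \<tau>] lin_compose[OF P(1)]
  define Q where "Q h = sweedler h (\<lambda>a b. sweedler (P a) (\<lambda>x y. \<tau> y b *s x))" for h
  have "lin scale Q" unfolding Q_def by (intro ls)
  moreover have "Q h \<in> D" for h
  proof -
    have "sweedler (P a) (\<lambda>x y. \<tau> y b *s x) \<in> D" for a b
      using D bilin_lin(1)[OF \<tau> lin_id, of b] P(2)[of a] by (auto simp: subcoalgebra_iff)
    then show ?thesis
      unfolding Q_def by (rule sweedler_in_subspace[OF subcoalgebra_subspace[OF D]])
  qed
  moreover have "Q h = h" if h: "h \<in> D" for h
  proof -
    have "Q h = sweedler h (\<lambda>a b. sweedler a (\<lambda>x y. \<tau> y b *s x))"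
      unfolding Q_def
      by (rule sweedler_cong_subcoalgebra[OF D h, of scale]) (intro bilinI ls | simp add: P(3))+
    also have "\<dots> = sweedler h (\<lambda>x w. sweedler w (\<lambda>y b. \<tau> y b *s x))"
      by (intro sweedler_assoc[of scale] ls)
    also have "\<dots> = sweedler h (\<lambda>x w. counit w *s x)"
      by (simp add: sweedler_scale_vec[symmetric] \<tau>_counit)
    also have "\<dots> = h" by (rule sweedler_counit_right[OF lin_id])
    finally show ?thesis .
  qed
  moreover have "Q (sweedler h (\<lambda>a b. \<phi> a *s b)) = sweedler (Q h) (\<lambda>a b. \<phi> a *s b)" if \<phi>: "lin (*) \<phi>" for \<phi> h
  proof -
    note ls = ls lin_compose[OF \<phi>]
    have L: "lin scale (\<lambda>h. sweedler h (\<lambda>a b. \<phi> a *s b))" by (intro ls)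
    have T: "lin scale (\<lambda>z. sweedler z (\<lambda>x y. \<tau> y b *s x))" for b by (intro ls)
    have "sweedler (Q h) (\<lambda>a b. \<phi> a *s b)
        = sweedler h (\<lambda>a b. sweedler (P a) (\<lambda>z y. sweedler z (\<lambda>x x'. (\<tau> y b * \<phi> x) *s x')))"
      unfolding Q_def by (simp add: lin_push_sweedler[OF L] linD(3)[OF L] scale_sweedler)
    also have "\<dots> = sweedler h (\<lambda>a b. sweedler (P a) (\<lambda>x z. sweedler z (\<lambda>x' y. (\<tau> y b * \<phi> x) *s x')))"
      by (subst sweedler_assoc[of scale]) (intro ls refl)+
    \<comment> \<open>The contraction of the left leg passes through \<open>P\<close>, which is
      already left colinear, so averaging on the right preserves that property.\<close>
    also have "\<dots> = sweedler h (\<lambda>a b. sweedler (P (sweedler a (\<lambda>x y. \<phi> x *s y))) (\<lambda>x y. \<tau> y b *s x))"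
      unfolding P(4)[OF \<phi>] by (simp add: lin_push_sweedler[OF T] linD(3)[OF T] scale_sweedler mult.commute)
    also have "\<dots> = sweedler h (\<lambda>z b. sweedler z (\<lambda>c a. sweedler (P a) (\<lambda>x y. (\<phi> c * \<tau> y b) *s x)))"
      by (simp add: lin_push_sweedler[OF P(1)] linD(3)[OF P(1)] lin_push_sweedler[OF T] linD(3)[OF T] scale_sweedler)
    also have "\<dots> = sweedler h (\<lambda>c z. sweedler z (\<lambda>a b. sweedler (P a) (\<lambda>x y. (\<phi> c * \<tau> y b) *s x)))"
      by (intro sweedler_assoc[of scale] ls)
    also have "\<dots> = sweedler h (\<lambda>c z. \<phi> c *s Q z)"
      unfolding Q_def by (simp add: scale_sweedler)
    also have "\<dots> = Q (sweedler h (\<lambda>a b. \<phi> a *s b))"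
      using \<open>lin scale Q\<close> by (simp add: lin_push_sweedler linD(3))
    finally show ?thesis ..
  qed
  moreover have "Q (sweedler h (\<lambda>a b. \<phi> b *s a)) = sweedler (Q h) (\<lambda>a b. \<phi> b *s a)" if \<phi>: "lin (*) \<phi>" for \<phi> h
  proof -
    note ls = ls lin_compose[OF \<phi>]
    have L: "lin scale (\<lambda>h. sweedler h (\<lambda>a b. \<phi> b *s a))" by (intro ls)
    have "sweedler (Q h) (\<lambda>a b. \<phi> b *s a)
        = sweedler h (\<lambda>a b. sweedler (P a) (\<lambda>z y. sweedler z (\<lambda>x x'. (\<tau> y b * \<phi> x') *s x)))"
      unfolding Q_def by (simp add: lin_push_sweedler[OF L] linD(3)[OF L] scale_sweedler)
    also have "\<dots> = sweedler h (\<lambda>a b. sweedler (P a) (\<lambda>x z. sweedler z (\<lambda>x' y. (\<tau> y b * \<phi> x') *s x)))"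
      by (subst sweedler_assoc[of scale]) (intro ls refl)+
    also have "\<dots> = sweedler h (\<lambda>a z. sweedler (P a) (\<lambda>x w. sweedler z (\<lambda>b b'. (\<tau> w b * \<phi> b') *s x)))"
      by (simp add: sweedler_scale_vec[symmetric] \<tau>_functional[OF \<phi>])
    also have "\<dots> = sweedler h (\<lambda>a z. sweedler z (\<lambda>b b'. sweedler (P a) (\<lambda>x w. (\<tau> w b * \<phi> b') *s x)))"
      by (subst sweedler_swap) (rule refl)
    also have "\<dots> = sweedler h (\<lambda>z b'. sweedler z (\<lambda>a b. sweedler (P a) (\<lambda>x w. (\<tau> w b * \<phi> b') *s x)))"
      by (intro sweedler_assoc[symmetric, of scale] ls)
    also have "\<dots> = sweedler h (\<lambda>z b. \<phi> b *s Q z)"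
      unfolding Q_def by (simp add: scale_sweedler mult.commute)
    also have "\<dots> = Q (sweedler h (\<lambda>a b. \<phi> b *s a))"
      using \<open>lin scale Q\<close> by (simp add: lin_push_sweedler linD(3))
    finally show ?thesis ..
  qed
  ultimately show thesis by (rule that)
qed

lemma coseparable_imp_cosemisimple: cosemisimple
proof (rule cosemisimpleI)
  fix D assume D: "subcoalgebra D"
  obtain Q where Q: "lin scale Q" "\<And>x. Q x \<in> D" "\<And>x. x \<in> D \<Longrightarrow> Q x = x"
    "\<And>\<phi> h. lin (*) \<phi> \<Longrightarrow> Q (sweedler h (\<lambda>a b. \<phi> a *s b)) = sweedler (Q h) (\<lambda>a b. \<phi> a *s b)"
    "\<And>\<phi> h. lin (*) \<phi> \<Longrightarrow> Q (sweedler h (\<lambda>a b. \<phi> b *s a)) = sweedler (Q h) (\<lambda>a b. \<phi> b *s a)"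
    by (rule bicolinear_projection[OF D]) (rule that)
  let ?E = "{x. Q x = 0}"
  have "sweedler 0 (\<lambda>a b. \<phi> a *s b) = 0" "sweedler 0 (\<lambda>a b. \<phi> b *s a) = 0" if \<phi>: "lin (*) \<phi>" for \<phi>
    by (intro linD(4)[of scale] lin_intros \<phi>)+
  then have "subcoalgebra ?E"
    unfolding subcoalgebra_iff by (auto simp: subspace_def linD[OF Q(1)] Q(4,5))
  moreover have "D \<inter> ?E = {0}"
    using Q(3) subspace_0[OF subcoalgebra_subspace[OF D]] linD(4)[OF Q(1)] by auto
  moreover have "\<exists>d\<in>D. \<exists>e\<in>?E. x = d + e" for x
  proof (intro bexI)
    show "x = Q x + (x - Q x)" by simp
    show "Q x \<in> D" "x - Q x \<in> ?E" by (simp_all add: Q linD[OF Q(1)])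
  qed
  ultimately show "\<exists>E. subcoalgebra E \<and> D \<inter> E = {0} \<and> (\<forall>x. \<exists>d\<in>D. \<exists>e\<in>E. x = d + e)"
    by blast
qed

end

end

section \<open>Hopf algebras and integrals\<close>

context hopf_algebra
begin

section \<open>Calculus with the antipode\<close>

lemma lin_mult: "lin scale f \<Longrightarrow> lin scale (\<lambda>x. f x * c)" "lin scale f \<Longrightarrow> lin scale (\<lambda>x. c * f x)"
  by (auto intro!: linI vector_space_axioms simp: linD distrib_left distrib_right
      mult_scale_left mult_scale_right)

lemmas hopf_lin = lin_intros lin_mult lin_compose[OF antipode_linear]

lemma sweedler_one: "bilin s F \<Longrightarrow> sweedler 1 F = F 1 1"
  using sweedler_cong_tensor[OF _ comult_one] by simp

lemma sweedler_mult:
  assumes "bilin s F"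
  shows "sweedler (g * h) F = sweedler g (\<lambda>a b. sweedler h (\<lambda>c d. F (a * c) (b * d)))"
proof -
  have "(\<Sum>(a, b)\<leftarrow>[(g1 * h1, g2 * h2). (g1, g2) \<leftarrow> t, (h1, h2) \<leftarrow> comult h]. F a b)
      = (\<Sum>(a, b)\<leftarrow>t. sweedler h (\<lambda>c d. F (a * c) (b * d)))" for t
    by (induction t) (auto simp: sweedler_def comp_def case_prod_unfold)
  then show ?thesis
    using sweedler_cong_tensor[OF assms comult_mult[of g h]] by (simp add: sweedler_def)
qed

lemma sweedler_antipode: "sweedler h (\<lambda>a b. antipode a * b) = counit h *s 1" "sweedler h (\<lambda>a b. a * antipode b) = counit h *s 1"
  using antipode_left antipode_right by (simp_all add: sweedler_def)

text \<open>\<open>E\<close> abstracts \<open>S(h\<^sub>1)h\<^sub>2\<close> and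
  \<open>h\<^sub>1S(h\<^sub>2)\<close>: coassociativity brings the pair together, and the counit
  axiom absorbs the resulting scalar into the remaining component. With the mirror image this yields
  the four rules \<open>cancel_antipode\<close>.\<close>

lemma sweedler_cancel_left:
  assumes E: "bilin scale E" and counit: "\<And>h. sweedler h E = counit h *s 1" and G: "bilin s G"
  shows "sweedler h (\<lambda>a y. sweedler y (\<lambda>b c. G (E a b) c)) = G 1 h"
proof -
  have "sweedler h (\<lambda>a y. sweedler y (\<lambda>b c. G (E a b) c)) = sweedler h (\<lambda>x c. sweedler x (\<lambda>a b. G (E a b) c))"
    by (intro sweedler_assoc[symmetric, of s] hopf_lin bilin_lin[OF G] bilin_lin[OF E])
  also have "\<dots> = sweedler h (\<lambda>x c. G (sweedler x E) c)"
  proof -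
    have "lin s (\<lambda>x. G x c)" for c by (intro bilin_lin[OF G] lin_id)
    from lin_push_sweedler[OF this] show ?thesis by simp
  qed
  also have "\<dots> = sweedler h (\<lambda>x c. s (counit x) (G 1 c))"
  proof -
    have "lin s (\<lambda>x. G x c)" for c by (intro bilin_lin[OF G] lin_id)
    from linD(3)[OF this] show ?thesis by (simp add: counit)
  qed
  also have "\<dots> = G 1 h" by (rule sweedler_counit_left) (intro bilin_lin[OF G] lin_id)
  finally show ?thesis .
qed

lemma sweedler_cancel_right:
  assumes E: "bilin scale E" and counit: "\<And>h. sweedler h E = counit h *s 1" and G: "bilin s G"
  shows "sweedler h (\<lambda>a y. sweedler y (\<lambda>b c. G a (E b c))) = G h 1"
proof -
  have l: "lin s (\<lambda>x. G a x)" for a by (intro bilin_lin[OF G] lin_id)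
  have "sweedler h (\<lambda>a y. sweedler y (\<lambda>b c. G a (E b c))) = sweedler h (\<lambda>a y. s (counit y) (G a 1))"
    using lin_push_sweedler[OF l, symmetric] linD(3)[OF l] by (simp add: counit)
  also have "\<dots> = G h 1" by (rule sweedler_counit_right) (intro bilin_lin[OF G] lin_id)
  finally show ?thesis .
qed

lemma bilin_antipode: "bilin scale (\<lambda>a b. antipode a * b)" "bilin scale (\<lambda>a b. a * antipode b)"
  by (intro bilinI hopf_lin)+

lemmas cancel_antipode =
  sweedler_cancel_left[OF bilin_antipode(1) sweedler_antipode(1)] sweedler_cancel_left[OF bilin_antipode(2) sweedler_antipode(2)]
  sweedler_cancel_right[OF bilin_antipode(1) sweedler_antipode(1)] sweedler_cancel_right[OF bilin_antipode(2) sweedler_antipode(2)]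

lemma antipode_one: "antipode 1 = 1"
  using sweedler_antipode(1)[of 1] sweedler_one[OF bilin_antipode(1)] by (simp add: counit_one)

text \<open>Insert \<open>g\<^sub>2h\<^sub>2S(h\<^sub>3)S(g\<^sub>3)\<close> behind \<open>S(g\<^sub>1h\<^sub>1)\<close>.\<close>

lemma antipode_mult: "antipode (g * h) = antipode h * antipode g"
proof -
  let ?S = antipode
  have G: "bilin scale (\<lambda>a b. ?S (a * h) * b)" for h by (intro bilinI hopf_lin)
  have "?S (g * h) = sweedler g (\<lambda>a x. sweedler x (\<lambda>b c. ?S (a * h) * (b * ?S c)))"
    using cancel_antipode(4)[OF G, of g h] by simp
  also have "\<dots> = sweedler g (\<lambda>a x. sweedler x (\<lambda>b c. sweedler h (\<lambda>u y. sweedler y (\<lambda>v w. ?S (a * u) * (b * (v * ?S w) * ?S c)))))"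
  proof -
    have "bilin scale (\<lambda>u t. ?S (a * u) * (b * t * ?S c))" for a b c by (intro bilinI hopf_lin)
    from cancel_antipode(4)[OF this] show ?thesis by simp
  qed
  also have "\<dots> = sweedler g (\<lambda>a x. sweedler x (\<lambda>b c. sweedler h (\<lambda>y w. sweedler y (\<lambda>u v. ?S (a * u) * (b * (v * ?S w) * ?S c)))))"
    by (subst sweedler_assoc[of scale]) (intro hopf_lin refl)+
  also have "\<dots> = sweedler g (\<lambda>x c. sweedler x (\<lambda>a b. sweedler h (\<lambda>y w. sweedler y (\<lambda>u v. ?S (a * u) * (b * (v * ?S w) * ?S c)))))"
    by (intro sweedler_assoc[symmetric, of scale] hopf_lin)
  also have "\<dots> = sweedler g (\<lambda>x c. sweedler h (\<lambda>y w. sweedler x (\<lambda>a b. sweedler y (\<lambda>u v. ?S (a * u) * (b * v) * (?S w * ?S c)))))"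
    by (subst sweedler_swap) (simp add: mult.assoc)
  also have "\<dots> = sweedler g (\<lambda>x c. sweedler h (\<lambda>y w. sweedler (x * y) (\<lambda>p q. ?S p * q) * (?S w * ?S c)))"
  proof -
    have "lin scale (\<lambda>x. x * (?S w * ?S c))" for w c by (intro hopf_lin)
    from lin_push_sweedler[OF this] show ?thesis by (simp add: sweedler_mult[OF bilin_antipode(1)])
  qed
  also have "\<dots> = sweedler g (\<lambda>x c. sweedler h (\<lambda>y w. counit x *s (counit y *s (?S w * ?S c))))"
    by (simp add: sweedler_antipode counit_mult mult_scale_left)
  also have "\<dots> = sweedler g (\<lambda>x c. counit x *s (?S h * ?S c))"
  proof -
    have "lin scale (\<lambda>w. ?S w * ?S c)" for c by (intro hopf_lin)
    from sweedler_counit_left[OF this] show ?thesis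
      by (simp add: scale_sweedler[symmetric] del: scale_scale)
  qed
  also have "\<dots> = ?S h * ?S g"
    by (intro sweedler_counit_left hopf_lin)
  finally show ?thesis .
qed

text \<open>Multiply \<open>\<Delta>(S(h\<^sub>1))\<close> by \<open>h\<^sub>2S(h\<^sub>5) \<otimes> h\<^sub>3S(h\<^sub>4)\<close>, whose sum is trivial.\<close>

lemma sweedler_antipode_arg:
  assumes F: "bilin s F"
  shows "sweedler (antipode h) F = sweedler h (\<lambda>a b. F (antipode b) (antipode a))"
proof -
  let ?S = antipode
  \<comment> \<open>\<open>G x c\<close> is \<open>F\<close> evaluated at
    \<open>\<Delta>(x)(S(c\<^sub>2) \<otimes> S(c\<^sub>1))\<close>. After the insertion
    \<open>x\<close> is \<open>S(h\<^sub>1)h\<^sub>2\<close>, and cancelling it leaves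
    \<open>G 1 h\<close>.\<close>
  define G where "G x c = sweedler x (\<lambda>m n. sweedler c (\<lambda>c1 c2. F (m * ?S c2) (n * ?S c1)))" for x c
  note ls = hopf_lin bilin_lin[OF F]
  have G: "bilin s G"
    unfolding G_def by (intro bilinI ls)
  have insert: "sweedler y (\<lambda>b c. sweedler b (\<lambda>b1 b2. sweedler c (\<lambda>c1 c2. F (u * b1 * ?S c2) (v * b2 * ?S c1))))
    = s (counit y) (F u v)" for u v y
  proof -
    have "sweedler y (\<lambda>b c. sweedler b (\<lambda>b1 b2. sweedler c (\<lambda>c1 c2. F (u * b1 * ?S c2) (v * b2 * ?S c1))))
      = sweedler y (\<lambda>b1 z. sweedler z (\<lambda>b2 c. sweedler c (\<lambda>c1 c2. F (u * b1 * ?S c2) (v * b2 * ?S c1))))"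
      by (intro sweedler_assoc[of s] ls)
    also have "\<dots> = sweedler y (\<lambda>b1 z. sweedler z (\<lambda>w c2. sweedler w (\<lambda>b2 c1. F (u * b1 * ?S c2) (v * b2 * ?S c1))))"
      by (subst sweedler_assoc[of s]) (intro ls refl)+
    also have "\<dots> = sweedler y (\<lambda>b1 z. sweedler z (\<lambda>b2 w. sweedler w (\<lambda>c1 c2. F (u * b1 * ?S c2) (v * (b2 * ?S c1)))))"
      by (subst sweedler_assoc[of s]) (intro ls refl | simp add: mult.assoc)+
    also have "\<dots> = sweedler y (\<lambda>b1 z. F (u * b1 * ?S z) v)"
    proof -
      have "bilin s (\<lambda>x c. F (u * b1 * ?S c) (v * x))" for b1 by (intro bilinI ls)
      from cancel_antipode(2)[OF this] show ?thesis by simp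
    qed
    also have "\<dots> = F (u * sweedler y (\<lambda>b c. b * ?S c)) v"
    proof -
      have "lin s (\<lambda>x. F (u * x) v)" by (intro ls)
      from lin_push_sweedler[OF this] show ?thesis by (simp add: mult.assoc)
    qed
    also have "\<dots> = s (counit y) (F u v)"
    proof -
      have "lin s (\<lambda>x. F (u * x) v)" by (intro ls)
      from linD(3)[OF this] show ?thesis by (simp add: sweedler_antipode)
    qed
    finally show ?thesis .
  qed
  have "sweedler (?S h) F = sweedler h (\<lambda>a y. s (counit y) (sweedler (?S a) F))"
    by (intro sweedler_counit_right[symmetric] ls)
  also have "\<dots> = sweedler h (\<lambda>a y. sweedler (?S a) (\<lambda>u v. s (counit y) (F u v)))"
  proof -
    have "vector_space s" using F linD(1) by blast
    from scale_push_sweedler[OF this] show ?thesis by simp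
  qed
  also have "\<dots> = sweedler h (\<lambda>a y. sweedler y (\<lambda>b c. sweedler (?S a) (\<lambda>u v. sweedler b (\<lambda>b1 b2. sweedler c (\<lambda>c1 c2. F (u * b1 * ?S c2) (v * b2 * ?S c1))))))"
    by (subst sweedler_swap) (simp add: insert)
  also have "\<dots> = sweedler h (\<lambda>a y. sweedler y (\<lambda>b c. G (?S a * b) c))"
    unfolding G_def by (subst sweedler_mult[of s]) (intro bilinI ls refl)+
  also have "\<dots> = G 1 h"
    by (rule cancel_antipode(1)[OF G])
  also have "\<dots> = sweedler h (\<lambda>a b. F (?S b) (?S a))"
    unfolding G_def by (subst sweedler_one[of s]) (intro bilinI ls | simp)+
  finally show ?thesis .
qed

section \<open>Shift identities and proportionality of integrals\<close>

lemma left_integral_iff: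
  "left_integral l \<longleftrightarrow> lin (*) l \<and> (\<forall>h. sweedler h (\<lambda>a b. l b *s a) = l h *s 1)"
  by (simp add: left_integral_def sweedler_def)

lemma right_integral_iff:
  "right_integral l \<longleftrightarrow> lin (*) l \<and> (\<forall>h. sweedler h (\<lambda>a b. l a *s b) = l h *s 1)"
  by (simp add: right_integral_def sweedler_def)

text \<open>Since \<open>l(x)1 = x\<^sub>1l(x\<^sub>2)\<close>, the right-hand side expands to
  \<open>S(h\<^sub>1)h\<^sub>2g\<^sub>1l(h\<^sub>3g\<^sub>2)\<close>, in which
  \<open>S(h\<^sub>1)h\<^sub>2\<close> cancels.\<close>

lemma left_integral_shift:
  assumes "left_integral l"
  shows "sweedler g (\<lambda>a b. l (h * b) *s a) = sweedler h (\<lambda>a b. l (b * g) *s antipode a)"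
proof -
  from assms have l: "lin (*) l" "\<And>h. sweedler h (\<lambda>a b. l b *s a) = l h *s 1"
    by (auto simp: left_integral_iff)
  note ls = hopf_lin lin_compose[OF l(1)]
  have M: "lin scale (\<lambda>x. c * x)" for c by (intro ls)
  have "sweedler h (\<lambda>a b. l (b * g) *s antipode a) = sweedler h (\<lambda>a b. antipode a * (l (b * g) *s 1))"
    by (simp add: mult_scale_right)
  also have "\<dots> = sweedler h (\<lambda>a b. sweedler b (\<lambda>b1 b2. sweedler g (\<lambda>g1 g2. l (b2 * g2) *s (antipode a * b1 * g1))))"
    unfolding l(2)[symmetric]
    by (subst sweedler_mult[of scale]) (intro bilinI ls | simp add: lin_push_sweedler[OF M] mult_scale_right mult.assoc)+
  also have "\<dots> = sweedler g (\<lambda>g1 g2. l (h * g2) *s (1 * g1))"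
  proof -
    have "bilin scale (\<lambda>x c. sweedler g (\<lambda>g1 g2. l (c * g2) *s (x * g1)))" by (intro bilinI ls)
    from cancel_antipode(1)[OF this] show ?thesis by simp
  qed
  finally show ?thesis by simp
qed

text \<open>Dually, the right-hand side expands to
  \<open>r(h\<^sub>1g\<^sub>1)h\<^sub>2g\<^sub>2S(g\<^sub>3)\<close>.\<close>

lemma right_integral_shift:
  assumes "right_integral r"
  shows "sweedler h (\<lambda>a b. r (a * g) *s b) = sweedler g (\<lambda>a b. r (h * a) *s antipode b)"
proof -
  from assms have r: "lin (*) r" "\<And>h. sweedler h (\<lambda>a b. r a *s b) = r h *s 1"
    by (auto simp: right_integral_iff)
  note ls = hopf_lin lin_compose[OF r(1)]
  have M: "lin scale (\<lambda>x. x * c)" for c by (intro ls)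
  have "sweedler g (\<lambda>a b. r (h * a) *s antipode b) = sweedler g (\<lambda>a b. (r (h * a) *s 1) * antipode b)"
    by (simp add: mult_scale_left)
  also have "\<dots> = sweedler g (\<lambda>a b. sweedler h (\<lambda>h1 h2. sweedler a (\<lambda>a1 a2. r (h1 * a1) *s (h2 * a2 * antipode b))))"
    unfolding r(2)[symmetric]
    by (subst sweedler_mult[of scale]) (intro bilinI ls | simp add: lin_push_sweedler[OF M] mult_scale_left)+
  also have "\<dots> = sweedler g (\<lambda>a b. sweedler a (\<lambda>a1 a2. sweedler h (\<lambda>h1 h2. r (h1 * a1) *s (h2 * a2 * antipode b))))"
    by (subst sweedler_swap) (rule refl)
  also have "\<dots> = sweedler g (\<lambda>a1 y. sweedler y (\<lambda>a2 b. sweedler h (\<lambda>h1 h2. r (h1 * a1) *s (h2 * (a2 * antipode b)))))"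
    by (subst sweedler_assoc[of scale]) (intro ls | simp add: mult.assoc)+
  also have "\<dots> = sweedler h (\<lambda>h1 h2. r (h1 * g) *s (h2 * 1))"
  proof -
    have "bilin scale (\<lambda>c x. sweedler h (\<lambda>h1 h2. r (h1 * c) *s (h2 * x)))" by (intro bilinI ls)
    from cancel_antipode(4)[OF this] show ?thesis by simp
  qed
  finally show ?thesis by simp
qed

text \<open>Both sides equal \<open>r(h\<^sub>1)l(h\<^sub>2)\<close>: apply \<open>r\<close> to
  \<open>h\<^sub>1l(h\<^sub>2) = l(h)1\<close>, or \<open>l\<close> to
  \<open>r(h\<^sub>1)h\<^sub>2 = r(h)1\<close>.\<close>

lemma left_right_integral_proportional:
  assumes "left_integral l" "right_integral r"
  shows "r 1 * l h = l 1 * r h"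
proof -
  from assms have l: "lin (*) l" "sweedler h (\<lambda>a b. l b *s a) = l h *s 1"
    and r: "lin (*) r" "sweedler h (\<lambda>a b. r a *s b) = r h *s 1"
    by (auto simp: left_integral_iff right_integral_iff)
  have "r 1 * l h = r (sweedler h (\<lambda>a b. l b *s a))"
    by (simp add: l(2) linD(3)[OF r(1)])
  also have "\<dots> = l (sweedler h (\<lambda>a b. r a *s b))"
    by (simp add: lin_push_sweedler[OF l(1)] lin_push_sweedler[OF r(1)] linD(3)[OF l(1)] linD(3)[OF r(1)] mult.commute)
  also have "\<dots> = l 1 * r h"
    by (simp add: r(2) linD(3)[OF l(1)])
  finally show ?thesis .
qed

section \<open>Integrals and cosemisimplicity\<close>

text \<open>Dual of Maschke's theorem. The integral property and
  \<open>\<Delta>(S(g)) = S(g\<^sub>2) \<otimes> S(g\<^sub>1)\<close> turn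
  \<open>l(hS(g\<^sub>1))g\<^sub>2\<close> into
  \<open>h\<^sub>1S(g\<^sub>2)g\<^sub>3l(h\<^sub>2S(g\<^sub>1))\<close>; cancelling
  \<open>S(g\<^sub>2)g\<^sub>3\<close> shows that the form is balanced.\<close>

lemma left_integral_imp_cosemisimple:
  assumes l: "left_integral l" and one: "l 1 = 1"
  shows cosemisimple
proof (rule coseparable_imp_cosemisimple)
  from l have ll: "lin (*) l" and li: "\<And>h. sweedler h (\<lambda>a b. l b *s a) = l h *s 1"
    by (auto simp: left_integral_iff)
  note ls = hopf_lin lin_compose[OF ll]
  let ?\<tau> = "\<lambda>h g. l (h * antipode g)"
  show "bilin (*) ?\<tau>" by (intro bilinI ls)
  show "sweedler h ?\<tau> = counit h" for h
    using lin_push_sweedler[OF ll, of h "\<lambda>a b. a * antipode b"]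
    by (simp add: sweedler_antipode linD(3)[OF ll] one)
  show "sweedler h (\<lambda>a b. ?\<tau> b g *s a) = sweedler g (\<lambda>a b. ?\<tau> h a *s b)" for g h
  proof -
    have M: "lin scale (\<lambda>x. x * b)" for b by (intro ls)
    have "sweedler g (\<lambda>a b. ?\<tau> h a *s b) = sweedler g (\<lambda>a b. sweedler (h * antipode a) (\<lambda>u v. l v *s u) * b)"
      by (simp add: li mult_scale_left)
    also have "\<dots> = sweedler g (\<lambda>a b. sweedler h (\<lambda>h1 h2. sweedler a (\<lambda>a1 a2. l (h2 * antipode a1) *s (h1 * antipode a2 * b))))"
    proof -
      have "bilin scale (\<lambda>u v. l v *s u)" "\<And>h1 h2. bilin scale (\<lambda>u v. l (h2 * v) *s (h1 * u))"
        by (intro bilinI ls)+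
      then show ?thesis
        by (simp add: sweedler_mult[of scale] sweedler_antipode_arg[of scale] lin_push_sweedler[OF M] mult_scale_left)
    qed
    also have "\<dots> = sweedler g (\<lambda>a b. sweedler a (\<lambda>a1 a2. sweedler h (\<lambda>h1 h2. l (h2 * antipode a1) *s (h1 * (antipode a2 * b)))))"
      by (subst sweedler_swap) (simp add: mult.assoc)
    also have "\<dots> = sweedler g (\<lambda>a1 y. sweedler y (\<lambda>a2 b. sweedler h (\<lambda>h1 h2. l (h2 * antipode a1) *s (h1 * (antipode a2 * b)))))"
      by (intro sweedler_assoc[of scale] ls)
    also have "\<dots> = sweedler h (\<lambda>h1 h2. l (h2 * antipode g) *s (h1 * 1))"
    proof -
      have "bilin scale (\<lambda>c x. sweedler h (\<lambda>h1 h2. l (h2 * antipode c) *s (h1 * x)))" by (intro bilinI ls)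
      from cancel_antipode(3)[OF this] show ?thesis by simp
    qed
    finally show ?thesis by simp
  qed
qed

lemma sweedler_in_kernel:
  assumes N: "subcoalgebra N" "n \<in> N" and \<phi>: "lin (*) \<phi>" "\<And>x. x \<in> N \<Longrightarrow> \<phi> x = 0"
  shows "sweedler n (\<lambda>a b. \<phi> a *s b) = 0" "sweedler n (\<lambda>a b. \<phi> b *s a) = 0"
proof -
  have 0: "bilin scale (\<lambda>a b. 0)" by (intro bilinI linI vector_space_axioms) simp_all
  have "sweedler n (\<lambda>a b. 0 :: 'h) = 0" by (simp add: sweedler_def case_prod_unfold)
  moreover have "sweedler n (\<lambda>a b. \<phi> a *s b) = sweedler n (\<lambda>a b. 0)"
    by (intro sweedler_cong_subcoalgebra[OF N, of scale] 0 bilinI lin_intros \<phi>) (simp add: \<phi>)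
  moreover have "sweedler n (\<lambda>a b. \<phi> b *s a) = sweedler n (\<lambda>a b. 0)"
    by (intro sweedler_cong_subcoalgebra[OF N, of scale] 0 bilinI lin_intros \<phi>) (simp add: \<phi>)
  ultimately show "sweedler n (\<lambda>a b. \<phi> a *s b) = 0" "sweedler n (\<lambda>a b. \<phi> b *s a) = 0" by simp_all
qed

lemma sweedler_scaled_one: "bilin scale F \<Longrightarrow> sweedler (c *s 1) F = c *s F 1 1"
  using sweedler_scale sweedler_one by metis

lemma subcoalgebra_scalars: "subcoalgebra (range (\<lambda>c. c *s 1))"
  unfolding subcoalgebra_iff
proof (intro conjI allI impI)
  show "subspace (range (\<lambda>c. c *s 1))"
  proof (rule subspaceI)
    show "0 \<in> range (\<lambda>c. c *s 1)" by (rule image_eqI[of _ _ 0]) simp_all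
    show "x + y \<in> range (\<lambda>c. c *s 1)" if "x \<in> range (\<lambda>c. c *s 1)" "y \<in> range (\<lambda>c. c *s 1)" for x y
      using that by (auto simp: scale_left_distrib[symmetric])
    show "c *s x \<in> range (\<lambda>c. c *s 1)" if "x \<in> range (\<lambda>c. c *s 1)" for c x
      using that by auto
  qed
  fix \<phi> d assume \<phi>: "lin (*) \<phi>" and "d \<in> range (\<lambda>c. c *s 1)"
  then obtain c where d: "d = c *s 1" by blast
  have "bilin scale (\<lambda>a b. \<phi> a *s b)" "bilin scale (\<lambda>a b. \<phi> b *s a)"
    by (intro bilinI lin_intros \<phi>)+
  from this[THEN sweedler_scaled_one]
  show "sweedler d (\<lambda>a b. \<phi> a *s b) \<in> range (\<lambda>c. c *s 1)" "sweedler d (\<lambda>a b. \<phi> b *s a) \<in> range (\<lambda>c. c *s 1)"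
    by (simp_all add: d)
qed

text \<open>
  A subcoalgebra \<open>N\<close> that is maximal among those avoiding \<open>1\<close> is a complement of \<open>k1\<close>; the integral is
  the projection along \<open>N\<close>.
\<close>

lemma cosemisimple_imp_integral:
  assumes cosemisimple
  obtains \<mu> where "left_integral \<mu>" "right_integral \<mu>" "\<mu> 1 = 1"
proof -
  have "subcoalgebra UNIV" by (simp add: subcoalgebra_iff)
  then obtain N where N: "subcoalgebra N" "N \<subseteq> UNIV" "1 \<notin> N"
    "\<And>M. subcoalgebra M \<Longrightarrow> M \<subseteq> UNIV \<Longrightarrow> N \<subset> M \<Longrightarrow> 1 \<in> M"
    by (rule subcoalgebra_maximal_avoiding[OF _ one_neq_zero]) (rule that)
  note Nsub = subcoalgebra_subspace[OF N(1)]
  obtain p where p: "lin scale p" "\<And>x. p x \<in> N" "\<And>x. x \<in> N \<Longrightarrow> p x = x"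
    by (rule projection_exists[OF Nsub]) (rule that)
  have "1 - p 1 \<noteq> 0" using p(2)[of 1] N(3) by auto
  then obtain \<psi> where \<psi>: "lin (*) \<psi>" "\<psi> (1 - p 1) = 1" by (rule functional_exists)
  \<comment> \<open>\<open>x - p x\<close> vanishes on \<open>N\<close>, and \<open>\<psi>\<close>
    is normalized at \<open>1 - p 1\<close>; hence \<open>\<phi>\<close> is 0 on \<open>N\<close>
    and 1 at 1.\<close>
  define \<phi> where "\<phi> x = \<psi> (x - p x)" for x
  have \<phi>: "lin (*) \<phi>" "\<phi> 1 = 1" "\<And>x. x \<in> N \<Longrightarrow> \<phi> x = 0"
    unfolding \<phi>_def using \<psi>(2) p(3)
    by (auto intro!: lin_compose[OF \<psi>(1)] lin_diff lin_id p(1) simp: linD(4)[OF \<psi>(1)])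
  have bil: "bilin scale (\<lambda>a b. \<phi> a *s b)" "bilin scale (\<lambda>a b. \<phi> b *s a)"
    by (intro bilinI lin_intros \<phi>(1))+
  let ?T = "{n + e |n e. n \<in> N \<and> e \<in> range (\<lambda>c. c *s 1)}"
  have T: "subspace ?T"
    by (intro subcoalgebra_subspace subcoalgebra_sum N(1) subcoalgebra_scalars)
  have simple: "D \<subseteq> ?T" if D: "simple_subcoalgebra D" for D
  proof (cases "D \<subseteq> N")
    case True
    have "n + 0 *s 1 \<in> ?T" if "n \<in> N" for n using that by blast
    with True show ?thesis by auto
  next
    \<comment> \<open>By maximality \<open>1 = n + d\<close>. Applying
      \<open>\<phi> \<otimes> id\<close> to \<open>\<Delta>(1) = 1 \<otimes> 1\<close> removes the
      contribution of \<open>n\<close> and puts 1 into \<open>D\<close>; simplicity then forces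
      \<open>D = k1\<close>.\<close>
    case False
    from D have Dsub: "subcoalgebra D" by (simp add: simple_subcoalgebra_def)
    note D0 = subspace_0[OF subcoalgebra_subspace[OF Dsub]] subspace_0[OF Nsub]
    let ?M = "{n + d |n d. n \<in> N \<and> d \<in> D}"
    have "n + 0 \<in> ?M" if "n \<in> N" for n using that D0 by blast
    then have "N \<subseteq> ?M" by auto
    moreover have "0 + d \<in> ?M" if "d \<in> D" for d using that D0 by blast
    then have "D \<subseteq> ?M" by auto
    ultimately have "N \<subset> ?M" using False by blast
    then have "1 \<in> ?M" by (intro N(4) subcoalgebra_sum N(1) Dsub subset_UNIV)
    then obtain n d where nd: "n \<in> N" "d \<in> D" "1 = n + d" by blast
    have "sweedler 1 (\<lambda>a b. \<phi> a *s b) = sweedler n (\<lambda>a b. \<phi> a *s b) + sweedler d (\<lambda>a b. \<phi> a *s b)"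
      unfolding nd(3) by (rule sweedler_add[OF bil(1)])
    then have "1 = sweedler d (\<lambda>a b. \<phi> a *s b)"
      using sweedler_one[OF bil(1)] sweedler_in_kernel(1)[OF N(1) nd(1) \<phi>(1,3)] \<phi>(2) by simp
    also have "\<dots> \<in> D" using Dsub nd(2) \<phi>(1) by (auto simp: subcoalgebra_iff)
    finally have sub: "range (\<lambda>c. c *s 1) \<subseteq> D"
      using subspace_scale[OF subcoalgebra_subspace[OF Dsub]] by auto
    have "E = {0} \<or> E = D" if "subcoalgebra E" "E \<subseteq> D" for E
      using D that by (simp add: simple_subcoalgebra_def)
    from this[OF subcoalgebra_scalars sub] have "D = range (\<lambda>c. c *s 1)"
    proof
      assume 0: "range (\<lambda>c. c *s (1 :: 'h)) = {0}"
      have "1 *s 1 \<in> range (\<lambda>c. c *s (1 :: 'h))" by (rule rangeI)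
      then show ?thesis unfolding 0 by simp
    qed (rule sym)
    moreover have "0 + e \<in> ?T" if "e \<in> range (\<lambda>c. c *s 1)" for e using that D0 by blast
    ultimately show ?thesis by auto
  qed
  have "span (\<Union>{D. simple_subcoalgebra D}) \<subseteq> ?T"
    by (rule span_minimal[OF _ T]) (use simple in blast)
  then have dec: "h \<in> ?T" for h using assms unfolding cosemisimple_def by blast
  have int: "sweedler h (\<lambda>a b. \<phi> b *s a) = \<phi> h *s 1 \<and> sweedler h (\<lambda>a b. \<phi> a *s b) = \<phi> h *s 1" for h
  proof -
    from dec[of h] obtain n c where h: "h = n + c *s 1" and n: "n \<in> N" by blast
    have "\<phi> h = c" using \<phi>(2) \<phi>(3)[OF n] by (simp add: h linD(2,3)[OF \<phi>(1)])
    then show ?thesis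
      using sweedler_in_kernel[OF N(1) n \<phi>(1,3)] sweedler_add[OF bil(1), of n "c *s 1"]
        sweedler_add[OF bil(2), of n "c *s 1"] bil[THEN sweedler_scaled_one, of c] \<phi>(2)
      by (simp add: h)
  qed
  show thesis
    by (rule that[of \<phi>]) (simp_all add: left_integral_iff right_integral_iff \<phi> int)
qed

lemma integral_unique:
  assumes "left_integral \<mu>" "right_integral \<mu>" "\<mu> 1 = 1" "left_integral l \<or> right_integral l"
  shows "l = (\<lambda>h. l 1 * \<mu> h)"
  using left_right_integral_proportional[of l \<mu>] left_right_integral_proportional[of \<mu> l] assms by auto

text \<open>\<open>co_frobenius\<close> provides a nonzero left integral \<open>l'\<close>. If
  \<open>l\<close> is a right integral, proportionality and \<open>l(1) = 1\<close> give
  \<open>l' = l'(1)l\<close>, so \<open>l'(1)\<close> is nonzero and \<open>l\<close> is left as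
  well. Cosemisimplicity then yields a two-sided \<open>\<mu>\<close>, and
  \<open>l = \<mu>\<close>.\<close>

lemma normalized_integral:
  assumes cofrob: co_frobenius and l: "left_integral l \<or> right_integral l" and one: "l 1 = 1"
  shows cosemisimple "left_integral l" "right_integral l"
proof -
  have left: "left_integral l" if r: "right_integral l"
  proof -
    from cofrob obtain l' where l': "left_integral l'" "l' \<noteq> (\<lambda>_. 0)"
      by (auto simp: co_frobenius_def)
    have eq: "l' h = l' 1 * l h" for h
      using left_right_integral_proportional[OF l'(1) r, of h] one by simp
    have "l' 1 \<noteq> 0"
    proof
      assume 0: "l' 1 = 0"
      have "l' h = 0" for h by (subst eq) (simp add: 0)
      with l'(2) show False by auto
    qed
    have "l' 1 *s sweedler h (\<lambda>a b. l b *s a) = l' 1 *s (l h *s 1)" for h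
      using l'(1) by (simp add: left_integral_iff scale_sweedler eq[symmetric])
    then have "sweedler h (\<lambda>a b. l b *s a) = l h *s 1" for h
      using \<open>l' 1 \<noteq> 0\<close> by (metis scale_left_imp_eq)
    with r show ?thesis by (auto simp: left_integral_iff right_integral_iff)
  qed
  with l show L: "left_integral l" by blast
  show "cosemisimple" by (rule left_integral_imp_cosemisimple[OF L one])
  then obtain \<mu> where \<mu>: "left_integral \<mu>" "right_integral \<mu>" "\<mu> 1 = 1"
    by (rule cosemisimple_imp_integral)
  have "l = \<mu>" using integral_unique[OF \<mu> l, unfolded one] by simp
  with \<mu> show "right_integral l" by simp
qed

section \<open>Integrals and the square of the antipode\<close>

text \<open>Apply \<open>S\<close> to the two antipode axioms: it reverses the products and, by
  \<open>S\<^sup>2 = id\<close>, removes the \<open>S\<close> already present.\<close>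

lemma involutory_sweedler_antipode:
  assumes involutory
  shows "sweedler h (\<lambda>a b. antipode b * a) = counit h *s 1" "sweedler h (\<lambda>a b. b * antipode a) = counit h *s 1"
proof -
  have SS: "antipode (antipode x) = x" for x
    using assms by (simp add: involutory_def fun_eq_iff)
  have "sweedler h (\<lambda>a b. antipode b * a) = antipode (sweedler h (\<lambda>a b. antipode a * b))"
    "sweedler h (\<lambda>a b. b * antipode a) = antipode (sweedler h (\<lambda>a b. a * antipode b))"
    by (simp_all add: lin_push_sweedler[OF antipode_linear] antipode_mult SS)
  then show "sweedler h (\<lambda>a b. antipode b * a) = counit h *s 1" "sweedler h (\<lambda>a b. b * antipode a) = counit h *s 1"
    unfolding sweedler_antipode by (simp_all add: linD(3)[OF antipode_linear] antipode_one)
qed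

text \<open>\<open>h = h\<^sub>1\<lambda>(S(h\<^sub>3)h\<^sub>2) = S\<^sup>2(h\<^sub>3)\<lambda>(S(h\<^sub>2)h\<^sub>1) = S\<^sup>2(h)\<close>\<close>

lemma left_integral_imp_involutory:
  assumes l: "left_integral l" and eq: "\<And>h. sweedler h (\<lambda>a b. l (antipode b * a)) = counit h"
  shows involutory
proof -
  from l have ll: "lin (*) l" by (simp add: left_integral_iff)
  note ls = hopf_lin lin_compose[OF ll]
  have "antipode (antipode h) = h" for h
  proof -
    have "h = sweedler h (\<lambda>a y. counit y *s a)"
      by (rule sweedler_counit_right[OF lin_id, symmetric])
    also have "\<dots> = sweedler h (\<lambda>a y. sweedler y (\<lambda>b c. l (antipode c * b) *s a))"
      by (simp add: sweedler_scale_vec[symmetric] eq)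
    also have "\<dots> = sweedler h (\<lambda>x c. sweedler x (\<lambda>a b. l (antipode c * b) *s a))"
      by (intro sweedler_assoc[symmetric, of scale] ls)
    also have "\<dots> = sweedler h (\<lambda>x c. sweedler c (\<lambda>b c. l (antipode b * x) *s antipode (antipode c)))"
    proof -
      have "bilin scale (\<lambda>a b. l (b * x) *s antipode a)" for x by (intro bilinI ls)
      from sweedler_antipode_arg[OF this] show ?thesis by (simp add: left_integral_shift[OF l])
    qed
    also have "\<dots> = sweedler h (\<lambda>y c. sweedler y (\<lambda>x b. l (antipode b * x) *s antipode (antipode c)))"
      by (intro sweedler_assoc[symmetric, of scale] ls)
    also have "\<dots> = sweedler h (\<lambda>y c. counit y *s antipode (antipode c))"
      by (simp add: sweedler_scale_vec[symmetric] eq)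
    also have "\<dots> = antipode (antipode h)" by (intro sweedler_counit_left ls)
    finally show ?thesis ..
  qed
  then show ?thesis by (simp add: involutory_def fun_eq_iff)
qed

text \<open>\<open>h = \<lambda>(h\<^sub>2S(h\<^sub>1))h\<^sub>3 = \<lambda>(h\<^sub>3S(h\<^sub>2))S\<^sup>2(h\<^sub>1) = S\<^sup>2(h)\<close>\<close>

lemma right_integral_imp_involutory:
  assumes r: "right_integral r" and eq: "\<And>h. sweedler h (\<lambda>a b. r (b * antipode a)) = counit h"
  shows involutory
proof -
  from r have lr: "lin (*) r" by (simp add: right_integral_iff)
  note ls = hopf_lin lin_compose[OF lr]
  have "antipode (antipode h) = h" for h
  proof -
    have "h = sweedler h (\<lambda>x c. counit x *s c)"
      by (rule sweedler_counit_left[OF lin_id, symmetric])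
    also have "\<dots> = sweedler h (\<lambda>x c. sweedler x (\<lambda>a b. r (b * antipode a) *s c))"
      by (simp add: sweedler_scale_vec[symmetric] eq)
    also have "\<dots> = sweedler h (\<lambda>a y. sweedler y (\<lambda>b c. r (b * antipode a) *s c))"
      by (intro sweedler_assoc[of scale] ls)
    also have "\<dots> = sweedler h (\<lambda>x y. sweedler x (\<lambda>a b. r (y * antipode b) *s antipode (antipode a)))"
    proof -
      have "bilin scale (\<lambda>a b. r (y * a) *s antipode b)" for y by (intro bilinI ls)
      from sweedler_antipode_arg[OF this] show ?thesis by (simp add: right_integral_shift[OF r])
    qed
    also have "\<dots> = sweedler h (\<lambda>a x. sweedler x (\<lambda>b y. r (y * antipode b) *s antipode (antipode a)))"
      by (intro sweedler_assoc[of scale] ls)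
    also have "\<dots> = sweedler h (\<lambda>a x. counit x *s antipode (antipode a))"
      by (simp add: sweedler_scale_vec[symmetric] eq)
    also have "\<dots> = antipode (antipode h)" by (intro sweedler_counit_right ls)
    finally show ?thesis ..
  qed
  then show ?thesis by (simp add: involutory_def fun_eq_iff)
qed

text \<open>
  Shifting twice gives \<open>S\<^sup>2(g\<^sub>1)\<mu>(g\<^sub>2h) = S(h\<^sub>1)\<mu>(h\<^sub>2g) = g\<^sub>1\<mu>(g\<^sub>2h)\<close>; then replace \<open>g \<otimes> h\<close> by
  \<open>g\<^sub>1 \<otimes> S(g\<^sub>2)\<close>.
\<close>

lemma cocommutative_imp_involutory:
  assumes l: "left_integral \<mu>" and one: "\<mu> 1 = 1" and comm: "cocommutative \<mu>"
  shows involutory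
proof -
  from l have ll: "lin (*) \<mu>" by (simp add: left_integral_iff)
  note ls = hopf_lin lin_compose[OF ll]
  have c: "\<mu> (g * h) = \<mu> (h * g)" for g h
    using comm by (auto simp: cocommutative_def)
  have shift: "sweedler g (\<lambda>a b. \<mu> (b * h) *s antipode (antipode a)) = sweedler g (\<lambda>a b. \<mu> (b * h) *s a)" for g h
  proof -
    have "sweedler g (\<lambda>a b. \<mu> (b * h) *s antipode (antipode a)) = antipode (sweedler h (\<lambda>a b. \<mu> (g * b) *s a))"
      unfolding left_integral_shift[OF l]
      by (simp add: lin_push_sweedler[OF antipode_linear] linD(3)[OF antipode_linear])
    also have "\<dots> = sweedler h (\<lambda>a b. \<mu> (b * g) *s antipode a)"
      by (simp add: lin_push_sweedler[OF antipode_linear] linD(3)[OF antipode_linear] c[of g])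
    also have "\<dots> = sweedler g (\<lambda>a b. \<mu> (b * h) *s a)"
      by (simp add: left_integral_shift[OF l, symmetric] c[of h])
    finally show ?thesis .
  qed
  have eps: "sweedler h (\<lambda>a b. \<mu> (a * antipode b)) = counit h" for h
    by (simp add: lin_push_sweedler[OF ll, symmetric] sweedler_antipode linD(3)[OF ll] one)
  \<comment> \<open>This is \<open>f(h) = f(h\<^sub>1)\<mu>(h\<^sub>2S(h\<^sub>3))\<close>, valid
    because \<open>\<mu>(1) = 1\<close>. For \<open>f = S\<^sup>2\<close> and \<open>f = id\<close>
    the right-hand sides agree by \<open>shift\<close>.\<close>
  have expand: "f h = sweedler h (\<lambda>x c. sweedler x (\<lambda>a b. \<mu> (b * antipode c) *s f a))" if f: "lin scale f" for f h
  proof -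
    have "f h = sweedler h (\<lambda>a y. counit y *s f a)"
      by (rule sweedler_counit_right[OF f, symmetric])
    also have "\<dots> = sweedler h (\<lambda>a y. sweedler y (\<lambda>b c. \<mu> (b * antipode c) *s f a))"
      by (simp add: sweedler_scale_vec[symmetric] eps)
    also have "\<dots> = sweedler h (\<lambda>x c. sweedler x (\<lambda>a b. \<mu> (b * antipode c) *s f a))"
      by (intro sweedler_assoc[symmetric, of scale] ls lin_compose[OF f])
    finally show ?thesis .
  qed
  have SS: "lin scale (\<lambda>x. antipode (antipode x))" by (intro ls)
  have "antipode (antipode h) = h" for h
    using expand[OF SS, of h] expand[OF lin_id, of h] by (simp add: shift)
  then show ?thesis by (simp add: involutory_def fun_eq_iff)
qed

text \<open>
  Both shifts applied to \<open>\<mu>(h\<^sub>1g)\<mu>(yh\<^sub>2)\<close> give \<open>\<mu>(hg\<^sub>1)\<mu>(yS(g\<^sub>2)) = \<mu>(S(y\<^sub>1)g)\<mu>(y\<^sub>2h)\<close>. For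
  \<open>g \<otimes> y\<close> replaced by \<open>g\<^sub>1 \<otimes> g\<^sub>2\<close> the two sides become \<open>\<mu>(hg)\<close> and \<open>\<mu>(gh)\<close>.
\<close>

lemma involutory_imp_cocommutative:
  assumes left: "left_integral \<mu>" and right: "right_integral \<mu>" and one: "\<mu> 1 = 1" and involutory
  shows "cocommutative \<mu>"
proof -
  from left have ll: "lin (*) \<mu>" by (simp add: left_integral_iff)
  note ls = hopf_lin lin_compose[OF ll]
  have exchange: "sweedler g (\<lambda>a b. \<mu> (h * a) * \<mu> (y * antipode b)) = sweedler y (\<lambda>a b. \<mu> (antipode a * g) * \<mu> (b * h))"
    for g h y
  proof -
    have 1: "lin (*) (\<lambda>x. \<mu> (y * x))" and 2: "lin (*) (\<lambda>x. \<mu> (x * g))" by (intro ls)+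
    have "sweedler g (\<lambda>a b. \<mu> (h * a) * \<mu> (y * antipode b)) = sweedler h (\<lambda>a b. \<mu> (a * g) * \<mu> (y * b))"
      using arg_cong[OF right_integral_shift[OF right, of h g], of "\<lambda>x. \<mu> (y * x)"]
      by (simp add: lin_push_sweedler[OF 1] linD(3)[OF 1])
    also have "\<dots> = sweedler y (\<lambda>a b. \<mu> (antipode a * g) * \<mu> (b * h))"
      using arg_cong[OF left_integral_shift[OF left, of h y], of "\<lambda>x. \<mu> (x * g)"]
      by (simp add: lin_push_sweedler[OF 2] linD(3)[OF 2] mult.commute)
    finally show ?thesis .
  qed
  \<comment> \<open>Here \<open>S\<^sup>2 = id\<close> enters: substituting
    \<open>g\<^sub>1 \<otimes> g\<^sub>2\<close> in \<open>exchange\<close> produces antipode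
    products in reversed order on both sides.\<close>
  have eps: "sweedler h (\<lambda>a b. \<mu> (antipode b * a)) = counit h" "sweedler h (\<lambda>a b. \<mu> (b * antipode a)) = counit h" for h
    by (simp_all add: lin_push_sweedler[OF ll, symmetric] involutory_sweedler_antipode[OF assms(4)] linD(3)[OF ll] one)
  have "\<mu> (h * g) = \<mu> (g * h)" for g h
  proof -
    have "\<mu> (h * g) = sweedler g (\<lambda>a z. counit z * \<mu> (h * a))"
      by (intro sweedler_counit_right[symmetric] ls)
    also have "\<dots> = sweedler g (\<lambda>a z. sweedler z (\<lambda>b c. \<mu> (h * a) * \<mu> (c * antipode b)))"
      by (simp only: times_sweedler[symmetric] eps) (simp only: mult.commute)
    also have "\<dots> = sweedler g (\<lambda>x c. sweedler x (\<lambda>a b. \<mu> (h * a) * \<mu> (c * antipode b)))"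
      by (intro sweedler_assoc[symmetric, of "(*)"] ls)
    also have "\<dots> = sweedler g (\<lambda>x c. sweedler c (\<lambda>a b. \<mu> (antipode a * x) * \<mu> (b * h)))"
      by (simp add: exchange)
    also have "\<dots> = sweedler g (\<lambda>y b. sweedler y (\<lambda>x a. \<mu> (b * h) * \<mu> (antipode a * x)))"
      by (subst mult.commute) (intro sweedler_assoc[symmetric, of "(*)"] ls)
    also have "\<dots> = sweedler g (\<lambda>y b. counit y * \<mu> (b * h))"
      by (simp only: times_sweedler[symmetric] eps) (simp only: mult.commute)
    also have "\<dots> = \<mu> (g * h)"
      by (intro sweedler_counit_left ls)
    finally show ?thesis .
  qed
  then show ?thesis by (auto simp: cocommutative_def)
qed

end

theorem proposition3p3:
  fixes scale :: "'k::field \<Rightarrow> 'h::ring_1 \<Rightarrow> 'h"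
    and \<Delta> :: "'h \<Rightarrow> ('h \<times> 'h) list"
    and \<epsilon> :: "'h \<Rightarrow> 'k"
    and S :: "'h \<Rightarrow> 'h"
  assumes hopf: "hopf_algebra scale \<Delta> \<epsilon> S"
    and cofrob: "hopf_algebra.co_frobenius scale \<Delta>"
  shows "let i = coalgebra.cosemisimple scale \<Delta> \<and> hopf_algebra.involutory S;
             ii = (\<exists>l. (hopf_algebra.left_integral scale \<Delta> l \<or> hopf_algebra.right_integral scale \<Delta> l)
                     \<and> l \<noteq> (\<lambda>_. 0)
                     \<and> (\<forall>h. (\<Sum>(h1, h2)\<leftarrow>\<Delta> h. l (S h2 * h1)) = \<epsilon> h));
             iii = (\<exists>l. (hopf_algebra.left_integral scale \<Delta> l \<or> hopf_algebra.right_integral scale \<Delta> l)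
                     \<and> l \<noteq> (\<lambda>_. 0)
                     \<and> (\<forall>h. (\<Sum>(h1, h2)\<leftarrow>\<Delta> h. l (h2 * S h1)) = \<epsilon> h));
             iv = coalgebra.cosemisimple scale \<Delta> \<and>
                  (\<exists>l. (hopf_algebra.left_integral scale \<Delta> l \<or> hopf_algebra.right_integral scale \<Delta> l)
                     \<and> l \<noteq> (\<lambda>_. 0)
                     \<and> hopf_algebra.cocommutative l)
         in (i \<longleftrightarrow> ii) \<and> (ii \<longleftrightarrow> iii) \<and> (iii \<longleftrightarrow> iv)"
proof -
  interpret hopf_algebra scale \<Delta> \<epsilon> S by fact
  define ii where "ii l \<longleftrightarrow> (left_integral l \<or> right_integral l) \<and> l \<noteq> (\<lambda>_. 0)
      \<and> (\<forall>h. sweedler h (\<lambda>a b. l (S b * a)) = \<epsilon> h)" for l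
  define iii where "iii l \<longleftrightarrow> (left_integral l \<or> right_integral l) \<and> l \<noteq> (\<lambda>_. 0)
      \<and> (\<forall>h. sweedler h (\<lambda>a b. l (b * S a)) = \<epsilon> h)" for l
  define iv where "iv l \<longleftrightarrow> (left_integral l \<or> right_integral l) \<and> l \<noteq> (\<lambda>_. 0) \<and> cocommutative l" for l
  have integral_lin: "lin (*) l" if "left_integral l \<or> right_integral l" for l
    using that by (auto simp: left_integral_iff right_integral_iff)
  have i_imp: "Ex ii \<and> Ex iii \<and> Ex iv" if i: cosemisimple involutory
  proof -
    obtain \<mu> where \<mu>: "left_integral \<mu>" "right_integral \<mu>" "\<mu> 1 = 1"
      using cosemisimple_imp_integral[OF i(1)] .
    then have l: "lin (*) \<mu>" and "\<mu> \<noteq> (\<lambda>_. 0)" using integral_lin by auto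
    then have "ii \<mu>" "iii \<mu>" "iv \<mu>"
      using \<mu> involutory_imp_cocommutative[OF \<mu> i(2)]
      by (auto simp: ii_def iii_def iv_def lin_push_sweedler[OF l, symmetric] involutory_sweedler_antipode[OF i(2)]
          linD(3)[OF l])
    then show ?thesis by blast
  qed
  have ii_imp: "cosemisimple \<and> involutory" if "ii l" for l
  proof -
    from that have l: "left_integral l \<or> right_integral l"
      and eq: "\<And>h. sweedler h (\<lambda>a b. l (S b * a)) = \<epsilon> h" by (auto simp: ii_def)
    have "bilin (*) (\<lambda>a b. l (S b * a))"
      by (intro bilinI hopf_lin lin_compose[OF integral_lin[OF l]])
    from sweedler_one[OF this] eq[of 1] have "l 1 = 1" by (simp add: antipode_one counit_one)
    \<comment> \<open>\<open>normalized_integral\<close> makes \<open>l\<close> two-sided, so the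
      left criterion applies here, and the right one for (iii), whichever kind of integral was
      given.\<close>
    from normalized_integral[OF cofrob l this] eq show ?thesis
      by (auto intro: left_integral_imp_involutory)
  qed
  have iii_imp: "cosemisimple \<and> involutory" if "iii l" for l
  proof -
    from that have l: "left_integral l \<or> right_integral l"
      and eq: "\<And>h. sweedler h (\<lambda>a b. l (b * S a)) = \<epsilon> h" by (auto simp: iii_def)
    have "bilin (*) (\<lambda>a b. l (b * S a))"
      by (intro bilinI hopf_lin lin_compose[OF integral_lin[OF l]])
    from sweedler_one[OF this] eq[of 1] have "l 1 = 1" by (simp add: antipode_one counit_one)
    from normalized_integral[OF cofrob l this] eq show ?thesis
      by (auto intro: right_integral_imp_involutory)
  qed
  have iv_imp: involutory if cs: cosemisimple and "iv l" for l
  proof -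
    from that have l: "left_integral l \<or> right_integral l" "l \<noteq> (\<lambda>_. 0)" "cocommutative l"
      by (auto simp: iv_def)
    obtain \<mu> where \<mu>: "left_integral \<mu>" "right_integral \<mu>" "\<mu> 1 = 1"
      using cosemisimple_imp_integral[OF cs] .
    from integral_unique[OF \<mu> l(1)] have eq: "l h = l 1 * \<mu> h" for h by (rule fun_cong)
    \<comment> \<open>Since \<open>l\<close> is a multiple of \<open>\<mu>\<close> by
      \<open>l 1\<close>, a nonzero factor lets \<open>\<mu>\<close> inherit cocommutativity from
      \<open>l\<close>.\<close>
    have "l 1 \<noteq> 0"
    proof
      assume 0: "l 1 = 0"
      have "l h = 0" for h by (subst eq) (simp add: 0)
      with l(2) show False by auto
    qed
    moreover have "l 1 * \<mu> (g * h) = l 1 * \<mu> (h * g)" for g h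
      using l(3) by (simp add: eq[symmetric] cocommutative_def)
    ultimately have "cocommutative \<mu>" by (simp add: cocommutative_def)
    with \<mu> show ?thesis using cocommutative_imp_involutory by blast
  qed
  have "(cosemisimple \<and> involutory \<longleftrightarrow> Ex ii) \<and> (Ex ii \<longleftrightarrow> Ex iii) \<and> (Ex iii \<longleftrightarrow> cosemisimple \<and> Ex iv)"
    using i_imp ii_imp iii_imp iv_imp by blast
  then show ?thesis
    unfolding Let_def ii_def iii_def iv_def sweedler_def .
qed

end
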